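(* Let $c\in(0,\infty)$ be given. Let $\mu_c^{(G)}$, $\mu_c^{(L)}$ and $\mu_c^{(J)}$ denote the limiting measures, as $N\to\infty$ in the high temperature regime $\beta=2c/N$, of the empirical distributions of the Gaussian beta ensembles, the beta Laguerre ensembles (with parameter $\alpha>0$) and the beta Jacobi ensembles (with parameters $a>-1$, $b>-1$), respectively. Then the following hold. (i) The standard Gaussian distribution $\mathcal N(0,1)$ and $\mu_c^{(G)}$ are linked by the Markov--Krein relation with parameter $c$, that is, for all $z\in\mathbb C\setminus\mathbb R$, $\int_{\mathbb R}(z-t)^{-c}\,d\nu(t)=\exp\left(-c\int_{\mathbb R}\log(z-u)\,d\mu_c^{(G)}(u)\right)$ with $\nu=\mathcal N(0,1)$. (ii) The gamma distribution $\mathrm{Gamma}(\alpha+c,1)$ and $\mu_c^{(L)}$ are linked by the Markov--Krein relation with parameter $c$. (iii) The beta distribution $\mathrm{Beta}(a+c+1,b+c+1)$ and $\mu_c^{(J)}$ are linked by the Markov--Krein relation with parameter $c$.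
   Context: Logarithm and powers are principal branches on $\mathbb C\setminus(-\infty,0]$: for $z=re^{i\theta}$ with $r>0$, $-\pi<\theta<\pi$, $\log z=\log r+i\theta$ and $z^\alpha=e^{\alpha\log z}$ for $\alpha\in\mathbb R$. Markov--Krein relation: a probability measure $\nu$ on $\mathbb R$ and a probability measure $\mu$ on $\mathbb R$ with $\int_{\mathbb R}\log(1+|u|)\,d\mu(u)<\infty$ are linked by the Markov--Krein relation with parameter $c>0$ if for all $z\in\mathbb C\setminus\mathbb R$, $$\int_{\mathbb R}\frac{1}{(z-t)^c}\,d\nu(t)=\exp\left(-c\int_{\mathbb R}\log(z-u)\,d\mu(u)\right).$$ Beta ensembles: for $\beta>0$, these are the laws of $(\lambda_1,\dots,\lambda_N)$ with joint density proportional to $\prod_{i<j}|\lambda_j-\lambda_i|^\beta\prod_{l=1}^N w(\lambda_l)$, where - Gaussian: $w(\lambda)=e^{-\lambda^2/2}$ on $(-\infty,\infty)$; - Laguerre: $w(\lambda)=\lambda^{\alpha-1}e^{-\lambda}$ on $(0,\infty)$, $\alpha>0$; - Jacobi: $w(\lambda)=\lambda^a(1-\lambda)^b$ on $(0,1)$, $a>-1$, $b>-1$. The empirical distribution is $L_N=\frac1N\sum_{i=1}^N\delta_{\lambda_i}$. It is known (earlier work) that, in each of the three cases with $\beta=2c/N$ ($c$ and the parameters $\alpha$, $a,b$ being fixed), $L_N$ converges weakly, almost surely, to a deterministic probability measure as $N\to\infty$, and that $\int f\,dL_N$ converges almost surely to the integral of $f$ against the limit for every continuous $f$ of polynomial growth.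 These deterministic limits are $\mu_c^{(G)},\mu_c^{(L)},\mu_c^{(J)}$. $\mathrm{Gamma}(\kappa,1)$ has density $x^{\kappa-1}e^{-x}/\Gamma(\kappa)$ on $(0,\infty)$; $\mathrm{Beta}(p,q)$ has density proportional to $x^{p-1}(1-x)^{q-1}$ on $(0,1)$. *)

theory Defs
  imports "HOL-Probability.Probability"
begin

text \<open>The law of \<open>(x 0, \<dots>, x (N - 1))\<close> is taken on the product of \<open>N\<close> copies of
  Lebesgue measure, whose points are the extensional functions on \<open>{..<N}\<close>.\<close>

definition beta_ensemble_weight ::
    "real \<Rightarrow> (real \<Rightarrow> real) \<Rightarrow> nat \<Rightarrow> (nat \<Rightarrow> real) \<Rightarrow> real" where
  "beta_ensemble_weight \<beta> w N x =
     (\<Prod>j<N. \<Prod>i<j. \<bar>x j - x i\<bar> powr \<beta>) * (\<Prod>l<N. w (x l))"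

definition beta_ensemble ::
    "'a measure \<Rightarrow> real \<Rightarrow> (real \<Rightarrow> real) \<Rightarrow> nat \<Rightarrow> (nat \<Rightarrow> 'a \<Rightarrow> real) \<Rightarrow> bool" where
  "beta_ensemble \<Omega> \<beta> w N X \<longleftrightarrow>
     (\<exists>C>0. distributed \<Omega> (\<Pi>\<^sub>M i\<in>{..<N}. lborel) (\<lambda>\<omega>. \<lambda>i\<in>{..<N}. X i \<omega>)
        (\<lambda>x. ennreal (C * beta_ensemble_weight \<beta> w N x)))"

definition gaussian_weight :: "real \<Rightarrow> real" where
  "gaussian_weight x = exp (- x\<^sup>2 / 2)"

definition laguerre_weight :: "real \<Rightarrow> real \<Rightarrow> real" where
  "laguerre_weight \<alpha> x = (if 0 < x then x powr (\<alpha> - 1) * exp (- x) else 0)"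

definition jacobi_weight :: "real \<Rightarrow> real \<Rightarrow> real \<Rightarrow> real" where
  "jacobi_weight a b x = (if 0 < x \<and> x < 1 then x powr a * (1 - x) powr b else 0)"

definition empirical_distribution :: "nat \<Rightarrow> (nat \<Rightarrow> real) \<Rightarrow> real measure" where
  "empirical_distribution N x = distr (uniform_count_measure {..<N}) borel x"

text \<open>The push-forward of the uniform measure on the indices counts repeated points with
  multiplicity:\<close>

lemma measure_empirical_distribution:
  assumes "A \<in> sets borel"
  shows "measure (empirical_distribution N x) A = (\<Sum>i<N. indicator A (x i)) / real N"
proof -
  have "measure (empirical_distribution N x) A =
      measure (uniform_count_measure {..<N}) (x -` A \<inter> {..<N})"
    unfolding empirical_distribution_def
    by (subst measure_distr) (use assms in \<open>auto simp: space_uniform_count_measure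
        measurable_def sets_uniform_count_measure\<close>)
  also have "\<dots> = real (card (x -` A \<inter> {..<N})) / real N"
    by (subst measure_uniform_count_measure) auto
  also have "real (card (x -` A \<inter> {..<N})) = (\<Sum>i<N. indicator A (x i))"
    by (subst sum.mono_neutral_cong_right[where S = "x -` A \<inter> {..<N}" and h = "\<lambda>_. 1"])
      (auto simp: indicator_def split: if_splits)
  finally show ?thesis .
qed

text \<open>\<open>X N i\<close> is the \<open>i\<close>-th particle of the ensemble of size \<open>N\<close>. Nothing is prescribed about
  the joint law of the ensembles of different sizes.\<close>

definition high_temperature_limit ::
    "'a measure \<Rightarrow> (nat \<Rightarrow> nat \<Rightarrow> 'a \<Rightarrow> real) \<Rightarrow> real \<Rightarrow> (real \<Rightarrow> real) \<Rightarrow> real measure \<Rightarrow> bool" where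
  "high_temperature_limit \<Omega> X c w \<mu> \<longleftrightarrow>
     prob_space \<Omega> \<and>
     (\<forall>N\<ge>1. beta_ensemble \<Omega> (2 * c / real N) w N (X N)) \<and>
     real_distribution \<mu> \<and>
     (AE \<omega> in \<Omega>. weak_conv_m (\<lambda>N. empirical_distribution N (\<lambda>i. X N i \<omega>)) \<mu>)"

definition gamma_distribution :: "real \<Rightarrow> real measure" where
  "gamma_distribution \<kappa> = density lborel
     (\<lambda>x. ennreal (if 0 < x then x powr (\<kappa> - 1) * exp (- x) / Gamma \<kappa> else 0))"

definition beta_distribution :: "real \<Rightarrow> real \<Rightarrow> real measure" where
  "beta_distribution p q = density lborel
     (\<lambda>x. ennreal (if 0 < x \<and> x < 1
       then x powr (p - 1) * (1 - x) powr (q - 1) / Beta p q else 0))"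

text \<open>\<open>powr\<close> and \<open>Ln\<close> are the principal branches; they are only evaluated off the real line.\<close>

definition markov_krein :: "real \<Rightarrow> real measure \<Rightarrow> real measure \<Rightarrow> bool" where
  "markov_krein c \<nu> \<mu> \<longleftrightarrow>
     real_distribution \<nu> \<and> real_distribution \<mu> \<and>
     integrable \<mu> (\<lambda>u. ln (1 + \<bar>u\<bar>)) \<and>
     (\<forall>z::complex. z \<notin> \<real> \<longrightarrow>
        (\<integral>t. 1 / (z - complex_of_real t) powr complex_of_real c \<partial>\<nu>) =
        exp (- complex_of_real c * (\<integral>u. Ln (z - complex_of_real u) \<partial>\<mu>)))"

end

theory Submission
  imports Defs "HOL-Real_Asymp.Real_Asymp"
begin

text \<open>
  The three weights satisfy a Pearson equation \<open>p w' = q w\<close> with \<open>p\<close> of degree at most two and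
  \<open>q\<close> affine: \<open>p = 1, x, x (1 - x)\<close> for the Gaussian, Laguerre and Jacobi ensembles. In each case
  the claimed partner \<open>\<nu>\<close> has the density \<open>\<rho> = w p\<^sup>c\<close> up to a constant, so that
  \<open>(p \<rho>)' = ((c + 1) p' + q) \<rho>\<close>. Write \<open>S z = \<integral> 1 / (z - u) d\<mu>\<close>. Both sides of the
  Markov--Krein relation solve the same linear equation
  \<open>p f'' - q f' = c ((1 + c) p''/2 + q') f\<close> in the upper half-plane, and their behaviour at
  \<open>i \<infinity>\<close> forces them to be equal.

  For \<open>f = \<integral> (z - t)\<^sup>-\<^sup>c d\<nu>\<close> the equation is an integration by parts against \<open>p \<rho>\<close>
  (\<open>integral_pearson_integrand_eq_0\<close>, \<open>stieltjes_ode\<close>).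
  For \<open>f = exp (- c \<integral> log (z - u) d\<mu>)\<close>, where \<open>f' = - c S f\<close>, it is the linearised form of the
  Riccati equation \<open>p (c S\<^sup>2 - S') + q S = (1 + c) p''/2 + q'\<close>, the limiting loop equation of the
  ensemble.

  The loop equation (\<open>loop_equation\<close>) is obtained without any differentiation of expectations.
  Move every particle by \<open>x \<mapsto> x + \<epsilon> p(x) g(x)\<close> with \<open>g(x) = Re (\<kappa> / (z - x))\<close>. The change of
  variables multiplies the density by a factor whose expectation is at most \<open>1\<close>. As
  \<open>\<beta> = 2 c / N\<close>, the pair interaction and the one-particle terms are of the same order, and this
  factor is at least \<open>exp (N (\<epsilon> A - K \<epsilon>\<^sup>2 + O(1/N)))\<close>, where \<open>A\<close> is the defect of the loop
  equation, a continuous functional of the empirical distribution. Almost sure convergence of the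
  empirical distribution and Fatou's lemma give \<open>\<epsilon> A \<le> K \<epsilon>\<^sup>2\<close> at the deterministic limit for
  small \<open>\<epsilon>\<close> of both signs, hence \<open>A = 0\<close>. The same argument with a fixed scaling
  \<open>x \<mapsto> s x\<close> bounds the first moment of \<open>\<mu>\<close> (\<open>high_temperature_limit_first_moment\<close>).

  For the uniqueness, the Wronskian of the two solutions is a multiple of an analytic continuation
  of \<open>w\<close>. The first moments of \<open>\<mu>\<close> and \<open>\<nu>\<close> show that on the imaginary axis it is
  \<open>O(y\<^sup>-\<^sup>2\<^sup>-\<^sup>2\<^sup>c)\<close>, whereas \<open>w\<close> decays no faster than \<open>y\<^sup>-\<^sup>2\<close>; so it vanishes and the solutions
  are proportional. The constant is \<open>1\<close> because both are asymptotic to \<open>z\<^sup>-\<^sup>c\<close>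
  (\<open>markov_krein_upper_half_plane\<close>).
\<close>

section \<open>Moving the particles of an ensemble\<close>

text \<open>  Only an inequality, because the range of \<open>\<phi>\<close> need not be the whole line; an upper bound for
  the transported mass is all that is needed later.\<close>

lemma nn_integral_monotone_substitution_le:
  fixes \<phi> \<phi>' :: "real \<Rightarrow> real" and h :: "real \<Rightarrow> ennreal"
  assumes deriv: "\<And>x. (\<phi> has_real_derivative \<phi>' x) (at x)"
    and cont: "continuous_on UNIV \<phi>'" and nonneg: "\<And>x. \<phi>' x \<ge> 0"
    and h[measurable]: "h \<in> borel_measurable borel"
  shows "(\<integral>\<^sup>+x. h (\<phi> x) * ennreal (\<phi>' x) \<partial>lborel) \<le> (\<integral>\<^sup>+y. h y \<partial>lborel)"
proof -
  have "continuous_on UNIV \<phi>"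
    using deriv by (meson DERIV_isCont continuous_at_imp_continuous_on)
  hence [measurable]: "\<phi> \<in> borel_measurable borel" "\<phi>' \<in> borel_measurable borel"
    using cont by (auto intro: borel_measurable_continuous_onI)
  let ?f = "\<lambda>n x. h (\<phi> x) * ennreal (\<phi>' x) * indicator {- (1 + real n)..1 + real n} x"
  have sup: "(SUP n. ?f n x) = h (\<phi> x) * ennreal (\<phi>' x)" for x
  proof (rule antisym)
    show "(SUP n. ?f n x) \<le> h (\<phi> x) * ennreal (\<phi>' x)"
      by (intro SUP_least) (auto split: split_indicator)
    obtain n where "real n \<ge> \<bar>x\<bar>" using real_arch_simple by blast
    hence "?f n x = h (\<phi> x) * ennreal (\<phi>' x)" by (auto split: split_indicator)
    thus "h (\<phi> x) * ennreal (\<phi>' x) \<le> (SUP n. ?f n x)"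
      using SUP_upper[of n UNIV "\<lambda>n. ?f n x"] by simp
  qed
  have inc: "incseq ?f"
    by (intro incseq_SucI le_funI mult_left_mono) (auto split: split_indicator)
  have le: "(\<integral>\<^sup>+x. ?f n x \<partial>lborel) \<le> (\<integral>\<^sup>+y. h y \<partial>lborel)" for n
  proof -
    have "(\<integral>\<^sup>+x. ?f n x \<partial>lborel)
        = (\<integral>\<^sup>+y. h y * indicator {\<phi> (- (1 + real n))..\<phi> (1 + real n)} y \<partial>lborel)"
      by (rule nn_integral_substitution_aux[symmetric])
        (use deriv nonneg in \<open>auto intro: continuous_on_subset[OF cont]\<close>)
    also have "\<dots> \<le> (\<integral>\<^sup>+y. h y \<partial>lborel)"
      by (intro nn_integral_mono) (auto split: split_indicator)
    finally show ?thesis .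
  qed
  have "(\<integral>\<^sup>+x. h (\<phi> x) * ennreal (\<phi>' x) \<partial>lborel) = (\<integral>\<^sup>+x. (SUP n. ?f n x) \<partial>lborel)"
    by (simp only: sup)
  also have "\<dots> = (SUP n. \<integral>\<^sup>+x. ?f n x \<partial>lborel)"
    by (rule nn_integral_monotone_convergence_SUP[OF inc]) measurable
  also have "\<dots> \<le> (\<integral>\<^sup>+y. h y \<partial>lborel)"
    by (intro SUP_least le)
  finally show ?thesis .
qed

lemma nn_integral_PiM_monotone_substitution_le:
  fixes \<phi> \<phi>' :: "real \<Rightarrow> real" and H :: "('i \<Rightarrow> real) \<Rightarrow> ennreal"
  assumes deriv: "\<And>x. (\<phi> has_real_derivative \<phi>' x) (at x)"
    and cont: "continuous_on UNIV \<phi>'" and nonneg: "\<And>x. \<phi>' x \<ge> 0"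
    and I: "finite I" and H: "H \<in> borel_measurable (\<Pi>\<^sub>M i\<in>I. lborel)"
  shows "(\<integral>\<^sup>+x. H (\<lambda>i\<in>I. \<phi> (x i)) * (\<Prod>i\<in>I. ennreal (\<phi>' (x i))) \<partial>(\<Pi>\<^sub>M i\<in>I. lborel))
    \<le> (\<integral>\<^sup>+x. H x \<partial>(\<Pi>\<^sub>M i\<in>I. lborel))"
  using I H
proof (induction I arbitrary: H rule: finite_induct)
  case empty
  interpret product_sigma_finite "\<lambda>_::'i. lborel :: real measure" ..
  show ?case by (simp add: PiM_empty nn_integral_count_space_finite)
next
  case (insert i I)
  interpret product_sigma_finite "\<lambda>_::'i. lborel :: real measure" ..
  let ?P = "\<lambda>J. \<Pi>\<^sub>M i\<in>J. (lborel :: real measure)"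
  have "continuous_on UNIV \<phi>"
    using deriv by (meson DERIV_isCont continuous_at_imp_continuous_on)
  hence [measurable]: "\<phi> \<in> borel_measurable borel" "\<phi>' \<in> borel_measurable borel"
    using cont by (auto intro: borel_measurable_continuous_onI)
  have [measurable]: "H \<in> borel_measurable (?P (insert i I))" by fact
  have [measurable]: "(\<lambda>x. \<lambda>j\<in>insert i I. \<phi> (x j)) \<in> measurable (?P (insert i I)) (?P (insert i I))"
    by measurable
  have mH: "(\<lambda>y. H (u(i := y))) \<in> borel_measurable borel" if "u \<in> space (?P I)" for u
  proof -
    have "(\<lambda>y. u(i := y)) \<in> measurable borel (?P (insert i I))"
      using that insert.hyps by (intro measurable_fun_upd[where J = I]) auto
    thus ?thesis by measurable
  qed
  define H2 where "H2 = (\<lambda>u. \<integral>\<^sup>+y. H (u(i := y)) \<partial>lborel)"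
  have "H2 \<in> borel_measurable (?P I)"
    unfolding H2_def by (intro lborel.borel_measurable_nn_integral) measurable
  note IH = insert.IH[OF this]
  have *: "(\<integral>\<^sup>+y. H (\<lambda>j\<in>insert i I. \<phi> ((x(i := y)) j)) * (\<Prod>j\<in>insert i I. ennreal (\<phi>' ((x(i := y)) j))) \<partial>lborel)
      \<le> H2 (\<lambda>j\<in>I. \<phi> (x j)) * (\<Prod>j\<in>I. ennreal (\<phi>' (x j)))"
    if x: "x \<in> space (?P I)" for x
  proof -
    let ?u = "\<lambda>j\<in>I. \<phi> (x j)"
    have u: "?u \<in> space (?P I)" by (auto simp: space_PiM)
    have eq1: "(\<lambda>j\<in>insert i I. \<phi> ((x(i := y)) j)) = ?u(i := \<phi> y)" for y
      using insert.hyps by (auto simp: fun_eq_iff)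
    have eq2: "(\<Prod>j\<in>insert i I. ennreal (\<phi>' ((x(i := y)) j)))
        = ennreal (\<phi>' y) * (\<Prod>j\<in>I. ennreal (\<phi>' (x j)))" for y
      using insert.hyps by (auto intro!: prod.cong arg_cong2[where f = "(*)"])
    have "(\<integral>\<^sup>+y. H (?u(i := \<phi> y)) * (ennreal (\<phi>' y) * (\<Prod>j\<in>I. ennreal (\<phi>' (x j)))) \<partial>lborel)
        = (\<integral>\<^sup>+y. H (?u(i := \<phi> y)) * ennreal (\<phi>' y) \<partial>lborel) * (\<Prod>j\<in>I. ennreal (\<phi>' (x j)))"
      using measurable_compose[OF \<open>\<phi> \<in> borel_measurable borel\<close> mH[OF u]]
      by (subst nn_integral_multc[symmetric]) (auto simp: mult_ac)
    also have "\<dots> \<le> H2 ?u * (\<Prod>j\<in>I. ennreal (\<phi>' (x j)))"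
      unfolding H2_def
      by (intro mult_right_mono nn_integral_monotone_substitution_le[OF deriv cont nonneg mH[OF u]]) auto
    finally show ?thesis unfolding eq1 eq2 .
  qed
  have "(\<integral>\<^sup>+x. H (\<lambda>j\<in>insert i I. \<phi> (x j)) * (\<Prod>j\<in>insert i I. ennreal (\<phi>' (x j))) \<partial>?P (insert i I))
     = (\<integral>\<^sup>+x. (\<integral>\<^sup>+y. H (\<lambda>j\<in>insert i I. \<phi> ((x(i := y)) j)) * (\<Prod>j\<in>insert i I. ennreal (\<phi>' ((x(i := y)) j))) \<partial>lborel) \<partial>?P I)"
    by (rule product_nn_integral_insert[OF insert.hyps]) measurable
  also have "\<dots> \<le> (\<integral>\<^sup>+x. H2 (\<lambda>j\<in>I. \<phi> (x j)) * (\<Prod>j\<in>I. ennreal (\<phi>' (x j))) \<partial>?P I)"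
    by (intro nn_integral_mono *)
  also have "\<dots> \<le> (\<integral>\<^sup>+x. H2 x \<partial>?P I)" by (rule IH)
  also have "\<dots> = (\<integral>\<^sup>+x. H x \<partial>?P (insert i I))"
    unfolding H2_def by (rule product_nn_integral_insert[OF insert.hyps, symmetric]) measurable
  finally show ?case .
qed

lemma beta_ensemble_weight_nonneg:
  assumes "\<And>x. w x \<ge> 0"
  shows "beta_ensemble_weight \<beta> w N x \<ge> 0"
  unfolding beta_ensemble_weight_def using assms by (intro mult_nonneg_nonneg prod_nonneg) auto

text \<open>  If moving all particles by \<open>\<phi>\<close> increases the density, Jacobian included, at least by the factor
  \<open>exp R\<close>, then the mean of \<open>exp R\<close> is bounded by the mass of the transported density. The
  hypothesis is a product inequality and not a lower bound on a quotient of densities, so nothing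
  has to be said about collisions or about points outside the support of \<open>w\<close>.\<close>

lemma beta_ensemble_transport:
  fixes \<phi> \<phi>' :: "real \<Rightarrow> real"
  assumes "prob_space \<Omega>" and ens: "beta_ensemble \<Omega> \<beta> w N X"
    and w: "\<And>x. w x \<ge> 0"
    and deriv: "\<And>x. (\<phi> has_real_derivative \<phi>' x) (at x)"
    and cont: "continuous_on UNIV \<phi>'" and nonneg: "\<And>x. \<phi>' x \<ge> 0"
    and R[measurable]: "R \<in> borel_measurable (\<Pi>\<^sub>M i\<in>{..<N}. lborel)"
    and le: "\<And>x. beta_ensemble_weight \<beta> w N x * exp (R x)
      \<le> beta_ensemble_weight \<beta> w N (\<lambda>i. \<phi> (x i)) * (\<Prod>l<N. \<phi>' (x l))"
  shows "(\<integral>\<^sup>+\<omega>. ennreal (exp (R (\<lambda>i\<in>{..<N}. X i \<omega>))) \<partial>\<Omega>) \<le> 1"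
proof -
  interpret prob_space \<Omega> by fact
  let ?P = "\<Pi>\<^sub>M i\<in>{..<N}. (lborel :: real measure)"
  let ?W = "beta_ensemble_weight \<beta> w N"
  obtain C where C: "C > 0" and D: "distributed \<Omega> ?P (\<lambda>\<omega>. \<lambda>i\<in>{..<N}. X i \<omega>) (\<lambda>x. ennreal (C * ?W x))"
    using ens unfolding beta_ensemble_def by auto
  have [measurable]: "(\<lambda>x. ennreal (C * ?W x)) \<in> borel_measurable ?P"
    using D by (rule distributed_borel_measurable)
  have restr: "?W (\<lambda>i\<in>{..<N}. \<phi> (x i)) = ?W (\<lambda>i. \<phi> (x i))" for x
    unfolding beta_ensemble_weight_def by (intro arg_cong2[where f = "(*)"] prod.cong) auto
  have "(\<integral>\<^sup>+\<omega>. ennreal (exp (R (\<lambda>i\<in>{..<N}. X i \<omega>))) \<partial>\<Omega>)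
      = (\<integral>\<^sup>+x. ennreal (C * ?W x) * ennreal (exp (R x)) \<partial>?P)"
    by (rule distributed_nn_integral[OF D, symmetric]) measurable
  also have "\<dots> \<le> (\<integral>\<^sup>+x. ennreal (C * ?W (\<lambda>i\<in>{..<N}. \<phi> (x i))) * (\<Prod>i<N. ennreal (\<phi>' (x i))) \<partial>?P)"
  proof (intro nn_integral_mono)
    fix x
    have "ennreal (C * ?W x) * ennreal (exp (R x)) = ennreal (C * (?W x * exp (R x)))"
      by (subst ennreal_mult''[symmetric]) (simp_all add: mult.assoc)
    also have "\<dots> \<le> ennreal (C * (?W (\<lambda>i. \<phi> (x i)) * (\<Prod>l<N. \<phi>' (x l))))"
      using C le by (intro ennreal_leI mult_left_mono) auto
    also have "\<dots> = ennreal (C * ?W (\<lambda>i\<in>{..<N}. \<phi> (x i))) * (\<Prod>i<N. ennreal (\<phi>' (x i)))"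
      by (simp add: restr prod_ennreal nonneg ennreal_mult'' prod_nonneg flip: mult.assoc)
    finally show "ennreal (C * ?W x) * ennreal (exp (R x)) \<le> \<dots>" .
  qed
  also have "\<dots> \<le> (\<integral>\<^sup>+x. ennreal (C * ?W x) \<partial>?P)"
    by (rule nn_integral_PiM_monotone_substitution_le[OF deriv cont nonneg]) auto
  also have "\<dots> = (\<integral>\<^sup>+\<omega>. 1 \<partial>\<Omega>)"
    using distributed_nn_integral[OF D, of "\<lambda>_. 1"] by simp
  also have "\<dots> = 1" by (simp add: emeasure_space_1)
  finally show ?thesis .
qed

text \<open>  A positive limit of \<open>T N\<close> would make \<open>exp ((N + 1) T N)\<close> diverge almost surely, against
  Fatou's lemma. The exponent carries \<open>Suc N\<close> because there is no ensemble of size \<open>0\<close>.\<close>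

lemma exponential_rate_nonpos:
  fixes T :: "nat \<Rightarrow> 'a \<Rightarrow> real"
  assumes "prob_space \<Omega>" and [measurable]: "\<And>N. T N \<in> borel_measurable \<Omega>"
    and le: "\<And>N. (\<integral>\<^sup>+\<omega>. ennreal (exp (real (Suc N) * T N \<omega>)) \<partial>\<Omega>) \<le> 1"
    and lim: "AE \<omega> in \<Omega>. (\<lambda>N. T N \<omega>) \<longlonglongrightarrow> \<tau>"
  shows "\<tau> \<le> 0"
proof (rule ccontr)
  interpret prob_space \<Omega> by fact
  assume "\<not> \<tau> \<le> 0"
  hence \<tau>: "\<tau> > 0" by simp
  have "AE \<omega> in \<Omega>. (2::ennreal) \<le> liminf (\<lambda>N. ennreal (exp (real (Suc N) * T N \<omega>)))"
    using lim
  proof eventually_elim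
    case (elim \<omega>)
    have "filterlim (\<lambda>N. T N \<omega> * real (Suc N)) at_top sequentially"
      by (rule filterlim_tendsto_pos_mult_at_top[OF elim \<tau>])
         (rule filterlim_compose[OF filterlim_real_sequentially filterlim_Suc])
    hence "\<forall>\<^sub>F N in sequentially. T N \<omega> * real (Suc N) \<ge> ln 2"
      by (simp add: filterlim_at_top)
    hence "\<forall>\<^sub>F N in sequentially. (2::ennreal) \<le> ennreal (exp (real (Suc N) * T N \<omega>))"
    proof eventually_elim
      case (elim N)
      hence "exp (ln 2) \<le> exp (real (Suc N) * T N \<omega>)" by (simp only: exp_le_cancel_iff mult.commute)
      hence "ennreal 2 \<le> ennreal (exp (real (Suc N) * T N \<omega>))" by (intro ennreal_leI) simp
      thus ?case by simp
    qed
    thus ?case by (rule Liminf_bounded)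
  qed
  hence "(\<integral>\<^sup>+\<omega>. 2 \<partial>\<Omega>) \<le> (\<integral>\<^sup>+\<omega>. liminf (\<lambda>N. ennreal (exp (real (Suc N) * T N \<omega>))) \<partial>\<Omega>)"
    by (rule nn_integral_mono_AE)
  also have "\<dots> \<le> liminf (\<lambda>N. \<integral>\<^sup>+\<omega>. ennreal (exp (real (Suc N) * T N \<omega>)) \<partial>\<Omega>)"
    by (rule nn_integral_liminf) measurable
  also have "\<dots> \<le> 1"
    by (rule order.trans[OF Liminf_le_Limsup Limsup_bounded]) (use le in \<open>auto intro!: always_eventually simp del: of_nat_Suc\<close>)
  finally have "(2::ennreal) \<le> 1" by (simp add: emeasure_space_1)
  thus False by simp
qed

section \<open>Stieltjes transforms and logarithmic potentials\<close>

text \<open>  Differentiation under the integral sign; on a finite measure a uniform bound of the derivative in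
  a disc dominates the difference quotients.\<close>

lemma has_field_derivative_integral_bounded:
  fixes f f' :: "complex \<Rightarrow> 'a \<Rightarrow> complex"
  assumes "finite_measure M" and r: "r > 0"
    and int: "\<And>z. z \<in> ball z0 r \<Longrightarrow> integrable M (f z)"
    and deriv: "\<And>z t. z \<in> ball z0 r \<Longrightarrow> t \<in> space M \<Longrightarrow> ((\<lambda>z. f z t) has_field_derivative f' z t) (at z)"
    and bound: "\<And>z t. z \<in> ball z0 r \<Longrightarrow> t \<in> space M \<Longrightarrow> norm (f' z t) \<le> B"
    and [measurable]: "f' z0 \<in> borel_measurable M"
  shows "((\<lambda>z. \<integral>t. f z t \<partial>M) has_field_derivative (\<integral>t. f' z0 t \<partial>M)) (at z0)"
  unfolding has_field_derivative_iff tendsto_at_iff_sequentially comp_def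
proof (intro allI impI)
  interpret finite_measure M by fact
  fix y :: "nat \<Rightarrow> complex"
  assume y: "\<forall>i. y i \<in> UNIV - {z0}" "y \<longlonglongrightarrow> z0"
  hence "\<forall>\<^sub>F n in sequentially. dist (y n) z0 < r" using r by (simp add: tendsto_iff)
  then obtain N where N: "\<And>n. n \<ge> N \<Longrightarrow> y n \<in> ball z0 r"
    unfolding eventually_sequentially by (auto simp: dist_commute)
  let ?y = "\<lambda>n. y (n + N)"
  have yb: "?y n \<in> ball z0 r" "?y n \<noteq> z0" for n using N y by auto
  have zb: "z0 \<in> ball z0 r" using r by simp
  have y': "?y \<longlonglongrightarrow> z0" using y(2) by (rule LIMSEQ_ignore_initial_segment)
  have "(\<lambda>n. \<integral>t. (f (?y n) t - f z0 t) / (?y n - z0) \<partial>M) \<longlonglongrightarrow> (\<integral>t. f' z0 t \<partial>M)"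
  proof (rule integral_dominated_convergence[where w = "\<lambda>_. B"])
    show "(\<lambda>t. (f (?y n) t - f z0 t) / (?y n - z0)) \<in> borel_measurable M" for n
      using int[OF yb(1)[of n]] int[OF zb] by (intro borel_measurable_divide borel_measurable_diff) auto
    show "AE t in M. (\<lambda>n. (f (?y n) t - f z0 t) / (?y n - z0)) \<longlonglongrightarrow> f' z0 t"
    proof (rule AE_I2)
      fix t assume "t \<in> space M"
      from deriv[OF zb this] show "(\<lambda>n. (f (?y n) t - f z0 t) / (?y n - z0)) \<longlonglongrightarrow> f' z0 t"
        unfolding has_field_derivative_iff tendsto_at_iff_sequentially comp_def
        using yb y' by (elim allE[of _ ?y]) auto
    qed
    show "AE t in M. norm ((f (?y n) t - f z0 t) / (?y n - z0)) \<le> B" for n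
    proof (rule AE_I2)
      fix t assume t: "t \<in> space M"
      have "norm (f (?y n) t - f z0 t) \<le> B * norm (?y n - z0)"
        by (rule field_differentiable_bound[OF convex_ball[of z0 r], where f' = "\<lambda>z. f' z t"])
          (use deriv t bound yb zb in \<open>auto intro: has_field_derivative_at_within\<close>)
      thus "norm ((f (?y n) t - f z0 t) / (?y n - z0)) \<le> B"
        using yb(2)[of n] by (simp add: norm_divide field_simps)
    qed
  qed auto
  also have "(\<lambda>n. \<integral>t. (f (?y n) t - f z0 t) / (?y n - z0) \<partial>M)
      = (\<lambda>n. ((\<integral>t. f (?y n) t \<partial>M) - (\<integral>t. f z0 t \<partial>M)) / (?y n - z0))"
    using int[OF yb(1)] int[OF zb] by (auto simp: fun_eq_iff)
  finally show "(\<lambda>n. ((\<integral>t. f (y n) t \<partial>M) - (\<integral>t. f z0 t \<partial>M)) / (y n - z0)) \<longlonglongrightarrow> (\<integral>t. f' z0 t \<partial>M)"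
    by (rule LIMSEQ_offset)
qed

text \<open>  The generalised Stieltjes transform of order \<open>s\<close>. Order \<open>c\<close> is the left-hand side of the
  Markov--Krein relation, and orders \<open>1\<close> and \<open>2\<close> are the Cauchy transform and minus its
  derivative; one derivative rule covers all of them.\<close>

definition stieltjes :: "real \<Rightarrow> real measure \<Rightarrow> complex \<Rightarrow> complex" where
  "stieltjes s \<nu> z = (\<integral>t. (z - complex_of_real t) powr (- complex_of_real s) \<partial>\<nu>)"

definition log_potential :: "real measure \<Rightarrow> complex \<Rightarrow> complex" where
  "log_potential \<mu> z = (\<integral>u. Ln (z - complex_of_real u) \<partial>\<mu>)"

lemma upper_half_not_nonpos: "Im w > 0 \<Longrightarrow> w \<notin> \<real>\<^sub>\<le>\<^sub>0"
  by (auto simp: complex_nonpos_Reals_iff)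

lemma norm_powr_minus:
  assumes "w \<noteq> 0"
  shows "norm (w powr (- complex_of_real s)) = norm w powr (- s)"
  using assms by (simp add: powr_def norm_exp_eq_Re)

lemma norm_powr_minus_le:
  assumes z: "Im z > 0" and "s \<ge> 0"
  shows "norm ((z - complex_of_real t) powr (- complex_of_real s)) \<le> Im z powr (- s)"
proof -
  have "z - complex_of_real t \<noteq> 0" using z by (auto simp: complex_eq_iff)
  moreover have "Im z \<le> norm (z - complex_of_real t)"
    using abs_Im_le_cmod[of "z - complex_of_real t"] z by simp
  ultimately show ?thesis
    using assms by (simp add: norm_powr_minus powr_mono2')
qed

lemma ball_upper_half:
  assumes "z \<in> ball z0 (Im z0 / 2)"
  shows "Im z \<ge> Im z0 / 2"
proof -
  have "\<bar>Im (z0 - z)\<bar> < Im z0 / 2"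
    using assms abs_Im_le_cmod[of "z0 - z"] by (simp add: dist_norm)
  thus ?thesis by (simp add: abs_if split: if_splits)
qed

lemma borel_measurable_powr_shift [measurable]:
  assumes "Im z > 0"
  shows "(\<lambda>t. (z - complex_of_real t) powr (- complex_of_real s)) \<in> borel_measurable borel"
  by (intro borel_measurable_continuous_onI continuous_intros)
     (use assms upper_half_not_nonpos in auto)

lemma borel_measurable_Ln_shift [measurable]:
  assumes "Im z > 0"
  shows "(\<lambda>t. Ln (z - complex_of_real t)) \<in> borel_measurable borel"
  by (intro borel_measurable_continuous_onI continuous_intros)
     (use assms upper_half_not_nonpos in auto)

lemma integrable_powr_shift:
  assumes "real_distribution \<nu>" "Im z > 0" "s \<ge> 0"
  shows "integrable \<nu> (\<lambda>t. (z - complex_of_real t) powr (- complex_of_real s))"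
proof -
  interpret real_distribution \<nu> by fact
  show ?thesis
    by (rule integrable_const_bound[of _ "Im z powr (- s)"])
      (use assms norm_powr_minus_le borel_measurable_powr_shift in auto)
qed

text \<open>  In the half-plane above height \<open>Im z\<close> the logarithm is Lipschitz with constant \<open>1 / Im z\<close>.
  Thus a first moment is enough for the logarithmic potential to exist and to be close to
  \<open>Ln z\<close> far up the imaginary axis.\<close>

lemma norm_Ln_shift_diff_le:
  assumes z: "Im z > 0"
  shows "norm (Ln (z - complex_of_real u) - Ln z) \<le> \<bar>u\<bar> / Im z"
proof -
  let ?S = "{w. Im w \<ge> Im z}"
  have nz: "w \<notin> \<real>\<^sub>\<le>\<^sub>0" "w \<noteq> 0" if "w \<in> ?S" for w
    using that z upper_half_not_nonpos[of w] by auto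
  have "norm (Ln (z - complex_of_real u) - Ln z) \<le> inverse (Im z) * norm (z - complex_of_real u - z)"
  proof (rule field_differentiable_bound[where S = ?S and f' = inverse])
    show "convex ?S" by (rule convex_halfspace_Im_ge)
    show "(Ln has_field_derivative inverse w) (at w within ?S)" if "w \<in> ?S" for w
      using nz[OF that] by (auto intro: has_field_derivative_at_within[OF has_field_derivative_Ln])
    show "norm (inverse w) \<le> inverse (Im z)" if "w \<in> ?S" for w
    proof -
      have "Im z \<le> norm w" using that abs_Im_le_cmod[of w] z by simp
      thus ?thesis using z by (simp add: norm_inverse le_imp_inverse_le)
    qed
  qed auto
  thus ?thesis by (simp add: field_simps)
qed

lemma integrable_Ln_shift:
  assumes "real_distribution \<mu>" and m: "integrable \<mu> (\<lambda>u. u)" and z: "Im z > 0"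
  shows "integrable \<mu> (\<lambda>u. Ln (z - complex_of_real u))"
proof -
  interpret real_distribution \<mu> by fact
  have "integrable \<mu> (\<lambda>u. Ln (z - complex_of_real u) - Ln z)"
  proof (rule Bochner_Integration.integrable_bound)
    show "integrable \<mu> (\<lambda>u. u / Im z)" using m by simp
    show "(\<lambda>u. Ln (z - complex_of_real u) - Ln z) \<in> borel_measurable \<mu>"
      using borel_measurable_Ln_shift[OF z] by auto
    show "AE u in \<mu>. norm (Ln (z - complex_of_real u) - Ln z) \<le> norm (u / Im z)"
      using norm_Ln_shift_diff_le[OF z] z by simp
  qed
  hence "integrable \<mu> (\<lambda>u. (Ln (z - complex_of_real u) - Ln z) + Ln z)"
    by (rule Bochner_Integration.integrable_add) simp
  thus ?thesis by simp
qed

lemma has_field_derivative_stieltjes: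
  assumes \<nu>: "real_distribution \<nu>" and s: "s > 0" and z: "Im z > 0"
  shows "(stieltjes s \<nu> has_field_derivative - complex_of_real s * stieltjes (s + 1) \<nu> z) (at z)"
proof -
  interpret real_distribution \<nu> by fact
  have pos: "Im w > 0" if "w \<in> ball z (Im z / 2)" for w using ball_upper_half[OF that] z by simp
  have "((\<lambda>z. \<integral>t. (z - complex_of_real t) powr (- complex_of_real s) \<partial>\<nu>) has_field_derivative
     (\<integral>t. - complex_of_real s * (z - complex_of_real t) powr (- complex_of_real (s + 1)) \<partial>\<nu>)) (at z)"
  proof (rule has_field_derivative_integral_bounded[where r = "Im z / 2" and
        B = "s * (Im z / 2) powr (- (s + 1))" and
        f' = "\<lambda>z t. - complex_of_real s * (z - complex_of_real t) powr (- complex_of_real (s + 1))"])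
    show "finite_measure \<nu>" by (rule finite_measure_axioms)
    show "Im z / 2 > 0" using z by simp
    show "integrable \<nu> (\<lambda>t. (w - complex_of_real t) powr (- complex_of_real s))"
      if "w \<in> ball z (Im z / 2)" for w
      using integrable_powr_shift[OF \<nu> pos[OF that]] s by simp
    show "((\<lambda>w. (w - complex_of_real t) powr (- complex_of_real s)) has_field_derivative
        - complex_of_real s * (w - complex_of_real t) powr (- complex_of_real (s + 1))) (at w)"
      if w: "w \<in> ball z (Im z / 2)" for w t
      using upper_half_not_nonpos[of "w - complex_of_real t"] pos[OF w]
      by (auto intro!: derivative_eq_intros simp: minus_diff_commute)
    show "norm (- complex_of_real s * (w - complex_of_real t) powr (- complex_of_real (s + 1)))
        \<le> s * (Im z / 2) powr (- (s + 1))"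
      if w: "w \<in> ball z (Im z / 2)" for w t
    proof -
      have "norm ((w - complex_of_real t) powr (- complex_of_real (s + 1))) \<le> Im w powr (- (s + 1))"
        using norm_powr_minus_le[OF pos[OF w], of "s + 1" t] s by simp
      also have "\<dots> \<le> (Im z / 2) powr (- (s + 1))"
        using ball_upper_half[OF w] z s by (intro powr_mono2') auto
      finally show ?thesis using s by (simp add: norm_mult mult_left_mono del: of_real_add)
    qed
    show "(\<lambda>t. - complex_of_real s * (z - complex_of_real t) powr (- complex_of_real (s + 1)))
        \<in> borel_measurable \<nu>"
      using borel_measurable_powr_shift[OF z, of "s + 1"] by (simp del: of_real_add)
  qed
  thus ?thesis unfolding stieltjes_def[abs_def] by simp
qed

lemma stieltjes_1: "Im z > 0 \<Longrightarrow> stieltjes 1 \<mu> z = (\<integral>u. 1 / (z - complex_of_real u) \<partial>\<mu>)"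
  unfolding stieltjes_def
  by (intro Bochner_Integration.integral_cong refl) (auto simp: powr_minus_divide)

lemma stieltjes_2: "Im z > 0 \<Longrightarrow> stieltjes 2 \<mu> z = (\<integral>u. 1 / (z - complex_of_real u)\<^sup>2 \<partial>\<mu>)"
  unfolding stieltjes_def
  by (intro Bochner_Integration.integral_cong refl) (auto simp: powr_minus_divide)

lemma has_field_derivative_log_potential:
  assumes \<mu>: "real_distribution \<mu>" and m: "integrable \<mu> (\<lambda>u. u)" and z: "Im z > 0"
  shows "(log_potential \<mu> has_field_derivative stieltjes 1 \<mu> z) (at z)"
proof -
  interpret real_distribution \<mu> by fact
  have pos: "Im w > 0" if "w \<in> ball z (Im z / 2)" for w using ball_upper_half[OF that] z by simp
  have "((\<lambda>z. \<integral>t. Ln (z - complex_of_real t) \<partial>\<mu>) has_field_derivative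
     (\<integral>t. (z - complex_of_real t) powr (- complex_of_real 1) \<partial>\<mu>)) (at z)"
  proof (rule has_field_derivative_integral_bounded[where r = "Im z / 2" and
        B = "(Im z / 2) powr (- 1)" and
        f' = "\<lambda>z t. (z - complex_of_real t) powr (- complex_of_real 1)"])
    show "finite_measure \<mu>" by (rule finite_measure_axioms)
    show "Im z / 2 > 0" using z by simp
    show "integrable \<mu> (\<lambda>t. Ln (w - complex_of_real t))"
      if "w \<in> ball z (Im z / 2)" for w
      using integrable_Ln_shift[OF \<mu> m pos[OF that]] .
    show "((\<lambda>w. Ln (w - complex_of_real t)) has_field_derivative
        (w - complex_of_real t) powr (- complex_of_real 1)) (at w)"
      if w: "w \<in> ball z (Im z / 2)" for w t
      using upper_half_not_nonpos[of "w - complex_of_real t"] pos[OF w]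
      by (auto intro!: derivative_eq_intros simp: powr_minus_divide divide_inverse)
    show "norm ((w - complex_of_real t) powr (- complex_of_real 1)) \<le> (Im z / 2) powr (- 1)"
      if w: "w \<in> ball z (Im z / 2)" for w t
    proof -
      have "norm ((w - complex_of_real t) powr (- complex_of_real 1)) \<le> Im w powr (- 1)"
        using norm_powr_minus_le[OF pos[OF w], of 1 t] by simp
      also have "\<dots> \<le> (Im z / 2) powr (- 1)"
        using ball_upper_half[OF w] z by (intro powr_mono2') auto
      finally show ?thesis .
    qed
    show "(\<lambda>t. (z - complex_of_real t) powr (- complex_of_real 1)) \<in> borel_measurable \<mu>"
      using borel_measurable_powr_shift[OF z, of 1] by simp
  qed
  thus ?thesis unfolding stieltjes_def log_potential_def[abs_def] by simp
qed

section \<open>Second-order equations and asymptotics on the imaginary axis\<close>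

text \<open>  By Abel's identity the Wronskian times \<open>exp (- V)\<close>, where \<open>V' = q / p\<close>, is constant in the upper
  half-plane; the limit along the imaginary axis identifies the constant as \<open>0\<close>.\<close>

lemma second_order_solutions_proportional:
  fixes p q :: "complex \<Rightarrow> complex" and k :: complex
  assumes F: "\<And>z. Im z > 0 \<Longrightarrow> (F has_field_derivative F' z) (at z)"
    and F': "\<And>z. Im z > 0 \<Longrightarrow> (F' has_field_derivative F'' z) (at z)"
    and G: "\<And>z. Im z > 0 \<Longrightarrow> (G has_field_derivative G' z) (at z)"
    and G': "\<And>z. Im z > 0 \<Longrightarrow> (G' has_field_derivative G'' z) (at z)"
    and odeF: "\<And>z. Im z > 0 \<Longrightarrow> p z * F'' z = q z * F' z + k * F z"
    and odeG: "\<And>z. Im z > 0 \<Longrightarrow> p z * G'' z = q z * G' z + k * G z"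
    and V: "\<And>z. Im z > 0 \<Longrightarrow> (V has_field_derivative V' z) (at z)"
    and V': "\<And>z. Im z > 0 \<Longrightarrow> p z * V' z = q z"
    and p: "\<And>z. Im z > 0 \<Longrightarrow> p z \<noteq> 0"
    and F0: "\<And>z. Im z > 0 \<Longrightarrow> F z \<noteq> 0"
    and lim: "((\<lambda>y. (F' (\<i> * of_real y) * G (\<i> * of_real y) - F (\<i> * of_real y) * G' (\<i> * of_real y))
        * exp (- V (\<i> * of_real y))) \<longlongrightarrow> 0) at_top"
  shows "\<exists>a. \<forall>z. Im z > 0 \<longrightarrow> G z = a * F z"
proof -
  let ?H = "{z. Im z > 0}"
  define W where "W = (\<lambda>z. F' z * G z - F z * G' z)"
  have conv: "convex ?H" by (rule convex_halfspace_Im_gt)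
  have "((\<lambda>z. W z * exp (- V z)) has_field_derivative 0) (at z within ?H)" if "z \<in> ?H" for z
  proof -
    from that have z: "Im z > 0" by simp
    have "p z * (F'' z * G z - F z * G'' z) = p z * (V' z * W z)"
      using odeF[OF z] odeG[OF z] V'[OF z] unfolding W_def by (simp add: algebra_simps) algebra
    hence eq: "F'' z * G z - F z * G'' z = V' z * W z" using p[OF z] by simp
    have "(W has_field_derivative F'' z * G z - F z * G'' z) (at z)"
      unfolding W_def using F[OF z] F'[OF z] G[OF z] G'[OF z]
      by (auto intro!: derivative_eq_intros)
    hence "((\<lambda>z. W z * exp (- V z)) has_field_derivative
        (F'' z * G z - F z * G'' z) * exp (- V z) + W z * (exp (- V z) * (- V' z))) (at z)"
      using V[OF z] by (auto intro!: derivative_eq_intros)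
    also have "(F'' z * G z - F z * G'' z) * exp (- V z) + W z * (exp (- V z) * (- V' z)) = 0"
      unfolding eq by (simp add: algebra_simps)
    finally show ?thesis by (rule has_field_derivative_at_within)
  qed
  from has_field_derivative_zero_constant[OF conv this]
  obtain d where d: "\<And>z. Im z > 0 \<Longrightarrow> W z * exp (- V z) = d" by auto
  have "((\<lambda>y::real. W (\<i> * of_real y) * exp (- V (\<i> * of_real y))) \<longlongrightarrow> d) at_top"
    by (rule tendsto_eventually)
      (use d in \<open>auto intro!: eventually_mono[OF eventually_gt_at_top[of 0]]\<close>)
  with lim have "d = 0" unfolding W_def
    using tendsto_unique trivial_limit_at_top_linorder by blast
  with d have W0: "W z = 0" if "Im z > 0" for z using that by fastforce
  have "((\<lambda>z. G z / F z) has_field_derivative 0) (at z within ?H)" if "z \<in> ?H" for z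
  proof -
    from that have z: "Im z > 0" by simp
    have "((\<lambda>z. G z / F z) has_field_derivative (G' z * F z - G z * F' z) / (F z * F z)) (at z)"
      using F[OF z] G[OF z] F0[OF z] by (auto intro!: derivative_eq_intros)
    also have "(G' z * F z - G z * F' z) = - W z" unfolding W_def by simp
    finally show ?thesis using W0[OF z] by (simp add: has_field_derivative_at_within)
  qed
  from has_field_derivative_zero_constant[OF conv this]
  obtain a where "\<And>z. Im z > 0 \<Longrightarrow> G z / F z = a" by auto
  thus ?thesis using F0 by (metis nonzero_eq_divide_eq)
qed

lemma norm_exp_minus_1_le:
  fixes w :: complex
  assumes "Re w \<le> 0"
  shows "norm (exp w - 1) \<le> norm w"
proof -
  have "norm (exp w - exp 0) \<le> 1 * norm (w - 0)"
    by (rule field_differentiable_bound[where S = "{w. Re w \<le> 0}" and f' = exp])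
      (use assms in \<open>auto intro: convex_halfspace_Re_le has_field_derivative_at_within[OF DERIV_exp]\<close>)
  thus ?thesis by simp
qed

lemma norm_imag_axis_shift:
  assumes "y > 0"
  shows "norm (\<i> * of_real y - complex_of_real t) \<ge> y"
  using abs_Im_le_cmod[of "\<i> * of_real y - complex_of_real t"] assms by simp

lemma norm_imag_axis_powr_le:
  assumes "y > 0" "s \<ge> 0"
  shows "norm ((\<i> * of_real y - complex_of_real t) powr (- complex_of_real s)) \<le> y powr (- s)"
  using norm_powr_minus_le[of "\<i> * of_real y" s t] assms by simp

lemma norm_stieltjes_le:
  assumes \<nu>: "real_distribution \<nu>" and y: "y > 0" and s: "s \<ge> 0"
  shows "norm (stieltjes s \<nu> (\<i> * of_real y)) \<le> y powr (- s)"
proof -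
  interpret real_distribution \<nu> by fact
  have [simp]: "prob UNIV = 1" using prob_space by simp
  have "norm (stieltjes s \<nu> (\<i> * of_real y)) \<le> (\<integral>t. y powr (- s) \<partial>\<nu>)"
    unfolding stieltjes_def
    by (rule Bochner_Integration.integral_norm_bound_integral)
      (use integrable_powr_shift[OF \<nu>] norm_imag_axis_powr_le y s in auto)
  thus ?thesis by simp
qed

text \<open>  The leading terms \<open>z\<^sup>-\<^sup>s\<close> cancel in \<open>f - z g\<close>, for \<open>f, g\<close> the transforms of order \<open>s\<close> and
  \<open>s + 1\<close>: the integrand is \<open>- t (z - t)\<^sup>-\<^sup>s\<^sup>-\<^sup>1\<close>. The additional power of \<open>1 / y\<close> in the bound
  is what makes the Wronskian decay fast enough in the Jacobi case.\<close>

lemma norm_stieltjes_euler_le: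
  assumes \<nu>: "real_distribution \<nu>" and m: "integrable \<nu> (\<lambda>t. t)" and y: "y > 0" and s: "s \<ge> 0"
  shows "norm (stieltjes s \<nu> (\<i> * of_real y) - \<i> * of_real y * stieltjes (s + 1) \<nu> (\<i> * of_real y))
    \<le> y powr (- (s + 1)) * (\<integral>t. \<bar>t\<bar> \<partial>\<nu>)"
proof -
  interpret real_distribution \<nu> by fact
  have [simp]: "prob UNIV = 1" using prob_space by simp
  let ?z = "\<i> * complex_of_real y"
  have i: "integrable \<nu> (\<lambda>t. (?z - complex_of_real t) powr (- complex_of_real s))"
    "integrable \<nu> (\<lambda>t. (?z - complex_of_real t) powr (- complex_of_real (s + 1)))"
    using integrable_powr_shift[OF \<nu>, of ?z] y s by (auto simp del: of_real_add)
  have "stieltjes s \<nu> ?z - ?z * stieltjes (s + 1) \<nu> ?z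
      = (\<integral>t. (?z - complex_of_real t) powr (- complex_of_real s)
           - ?z * (?z - complex_of_real t) powr (- complex_of_real (s + 1)) \<partial>\<nu>)"
    unfolding stieltjes_def using i by (simp del: of_real_add)
  also have "\<dots> = (\<integral>t. - complex_of_real t * (?z - complex_of_real t) powr (- complex_of_real (s + 1)) \<partial>\<nu>)"
  proof (intro Bochner_Integration.integral_cong refl)
    fix t
    have "?z - complex_of_real t \<noteq> 0" using y by (auto simp: complex_eq_iff)
    hence "(?z - complex_of_real t) powr (- complex_of_real s)
        = (?z - complex_of_real t) * (?z - complex_of_real t) powr (- complex_of_real (s + 1))"
      by (simp add: powr_diff)
    thus "(?z - complex_of_real t) powr (- complex_of_real s)
           - ?z * (?z - complex_of_real t) powr (- complex_of_real (s + 1))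
        = - complex_of_real t * (?z - complex_of_real t) powr (- complex_of_real (s + 1))"
      by (simp add: algebra_simps)
  qed
  also have "norm \<dots> \<le> (\<integral>t. y powr (- (s + 1)) * \<bar>t\<bar> \<partial>\<nu>)"
  proof (rule Bochner_Integration.integral_norm_bound_integral)
    have le: "norm (- complex_of_real t * (?z - complex_of_real t) powr (- complex_of_real (s + 1)))
        \<le> y powr (- (s + 1)) * \<bar>t\<bar>" for t
      using norm_imag_axis_powr_le[OF y, of "s + 1" t] s
      by (simp add: norm_mult mult.commute mult_left_mono del: of_real_add)
    show i2: "integrable \<nu> (\<lambda>t. y powr (- (s + 1)) * \<bar>t\<bar>)" using m by auto
    show "integrable \<nu> (\<lambda>t. - complex_of_real t * (?z - complex_of_real t) powr (- complex_of_real (s + 1)))"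
    proof (rule Bochner_Integration.integrable_bound[OF i2])
      show "(\<lambda>t. - complex_of_real t * (?z - complex_of_real t) powr (- complex_of_real (s + 1)))
          \<in> borel_measurable \<nu>"
        using borel_measurable_powr_shift[of ?z "s + 1"] y by (simp del: of_real_add)
    qed (use le in \<open>auto intro: order.trans[OF _ abs_ge_self] simp del: of_real_add\<close>)
    show "norm (- complex_of_real t * (?z - complex_of_real t) powr (- complex_of_real (s + 1)))
        \<le> y powr (- (s + 1)) * \<bar>t\<bar>" for t by (rule le)
  qed
  finally show ?thesis by simp
qed

lemma norm_log_potential_diff_le:
  assumes \<mu>: "real_distribution \<mu>" and m: "integrable \<mu> (\<lambda>u. u)" and y: "y > 0"
  shows "norm (log_potential \<mu> (\<i> * of_real y) - Ln (\<i> * of_real y)) \<le> (\<integral>u. \<bar>u\<bar> \<partial>\<mu>) / y"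
proof -
  interpret real_distribution \<mu> by fact
  have [simp]: "prob UNIV = 1" using prob_space by simp
  let ?z = "\<i> * complex_of_real y"
  have i: "integrable \<mu> (\<lambda>u. Ln (?z - complex_of_real u))"
    using integrable_Ln_shift[OF \<mu> m] y by simp
  hence "log_potential \<mu> ?z - Ln ?z = (\<integral>u. Ln (?z - complex_of_real u) - Ln ?z \<partial>\<mu>)"
    unfolding log_potential_def by simp
  also have "norm \<dots> \<le> (\<integral>u. \<bar>u\<bar> / y \<partial>\<mu>)"
    by (rule Bochner_Integration.integral_norm_bound_integral)
      (use i m y norm_Ln_shift_diff_le[of ?z] in auto)
  finally show ?thesis by simp
qed

text \<open>  On the imaginary axis \<open>\<bar>z - u\<bar> \<ge> y\<close> for every real \<open>u\<close>, so the real part of the potential is at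
  least \<open>ln y\<close>.\<close>

lemma norm_exp_log_potential_le:
  assumes \<mu>: "real_distribution \<mu>" and m: "integrable \<mu> (\<lambda>u. u)" and y: "y > 0" and c: "c \<ge> 0"
  shows "norm (exp (- complex_of_real c * log_potential \<mu> (\<i> * of_real y))) \<le> y powr (- c)"
proof -
  interpret real_distribution \<mu> by fact
  have [simp]: "prob UNIV = 1" using prob_space by simp
  let ?z = "\<i> * complex_of_real y"
  have i: "integrable \<mu> (\<lambda>u. Ln (?z - complex_of_real u))"
    using integrable_Ln_shift[OF \<mu> m] y by simp
  have "ln y = (\<integral>u. ln y \<partial>\<mu>)" by simp
  also have "\<dots> \<le> (\<integral>u. Re (Ln (?z - complex_of_real u)) \<partial>\<mu>)"
  proof (rule integral_mono)
    show "integrable \<mu> (\<lambda>u. Re (Ln (?z - complex_of_real u)))" using i by simp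
    show "ln y \<le> Re (Ln (?z - complex_of_real u))" for u
    proof -
      have "?z - complex_of_real u \<noteq> 0" using y by (auto simp: complex_eq_iff)
      thus ?thesis using norm_imag_axis_shift[OF y, of u] y by simp
    qed
  qed simp
  also have "\<dots> = Re (log_potential \<mu> ?z)" unfolding log_potential_def using i by simp
  finally have "- c * Re (log_potential \<mu> ?z) \<le> - c * ln y" using c by (simp add: mult_left_mono)
  thus ?thesis using y by (simp add: norm_exp_eq_Re powr_def)
qed

lemma tendsto_exp_log_potential_normalized:
  assumes \<mu>: "real_distribution \<mu>" and m: "integrable \<mu> (\<lambda>u. u)"
  shows "((\<lambda>y. exp (complex_of_real c * Ln (\<i> * of_real y)) *
     exp (- complex_of_real c * log_potential \<mu> (\<i> * of_real y))) \<longlongrightarrow> 1) at_top"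
proof -
  let ?D = "\<lambda>y. log_potential \<mu> (\<i> * of_real y) - Ln (\<i> * of_real y)"
  have "(?D \<longlongrightarrow> 0) at_top"
  proof (rule Lim_null_comparison)
    show "\<forall>\<^sub>F y in at_top. norm (?D y) \<le> (\<integral>u. \<bar>u\<bar> \<partial>\<mu>) / y"
      using eventually_gt_at_top[of 0] by eventually_elim (rule norm_log_potential_diff_le[OF \<mu> m])
    show "((\<lambda>y. (\<integral>u. \<bar>u\<bar> \<partial>\<mu>) / y) \<longlongrightarrow> 0) at_top"
      by (rule real_tendsto_divide_at_top[OF tendsto_const filterlim_ident])
  qed
  hence "((\<lambda>y. exp (- complex_of_real c * ?D y)) \<longlongrightarrow> exp (- complex_of_real c * 0)) at_top"
    by (intro tendsto_intros)
  thus ?thesis by (simp add: exp_add[symmetric] algebra_simps)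
qed

lemma tendsto_stieltjes_normalized:
  assumes \<nu>: "real_distribution \<nu>" and m: "integrable \<nu> (\<lambda>t. t)" and c: "c \<ge> 0"
  shows "((\<lambda>y. exp (complex_of_real c * Ln (\<i> * of_real y)) * stieltjes c \<nu> (\<i> * of_real y)) \<longlongrightarrow> 1) at_top"
proof -
  interpret real_distribution \<nu> by fact
  have [simp]: "prob UNIV = 1" using prob_space by simp
  let ?E = "\<lambda>y. exp (complex_of_real c * Ln (\<i> * of_real y)) * stieltjes c \<nu> (\<i> * of_real y)"
  have bound: "norm (?E y - 1) \<le> c * (\<integral>t. \<bar>t\<bar> \<partial>\<nu>) / y" if y: "y > 0" for y
  proof -
    let ?z = "\<i> * complex_of_real y"
    let ?D = "\<lambda>t. Ln (?z - complex_of_real t) - Ln ?z"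
    have i: "integrable \<nu> (\<lambda>t. (?z - complex_of_real t) powr (- complex_of_real c))"
      using integrable_powr_shift[OF \<nu>, of ?z] y c by auto
    have nz: "?z - complex_of_real t \<noteq> 0" for t using y by (auto simp: complex_eq_iff)
    have eq: "exp (complex_of_real c * Ln ?z) * (?z - complex_of_real t) powr (- complex_of_real c)
        = exp (- complex_of_real c * ?D t)" for t
      using nz[of t] by (simp add: powr_def exp_add[symmetric] algebra_simps)
    have i2: "integrable \<nu> (\<lambda>t. exp (- complex_of_real c * ?D t))"
      unfolding eq[symmetric] using i by simp
    have "?E y - 1 = (\<integral>t. exp (- complex_of_real c * ?D t) - 1 \<partial>\<nu>)"
      using i2 unfolding stieltjes_def eq[symmetric] by simp
    also have "norm \<dots> \<le> (\<integral>t. c * \<bar>t\<bar> / y \<partial>\<nu>)"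
    proof (rule Bochner_Integration.integral_norm_bound_integral)
      show "integrable \<nu> (\<lambda>t. exp (- complex_of_real c * ?D t) - 1)" using i2 by simp
      show "integrable \<nu> (\<lambda>t. c * \<bar>t\<bar> / y)" using m by simp
      show "norm (exp (- complex_of_real c * ?D t) - 1) \<le> c * \<bar>t\<bar> / y" for t
      proof -
        have "ln y \<le> ln (norm (?z - complex_of_real t))"
          using norm_imag_axis_shift[OF y, of t] y by simp
        hence "Re (- complex_of_real c * ?D t) \<le> 0"
          using c y nz[of t] by (simp add: norm_mult mult_left_mono)
        from norm_exp_minus_1_le[OF this]
        have "norm (exp (- complex_of_real c * ?D t) - 1) \<le> c * norm (?D t)"
          using c by (simp add: norm_mult)
        also have "\<dots> \<le> c * (\<bar>t\<bar> / y)"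
          using norm_Ln_shift_diff_le[of ?z t] y c by (intro mult_left_mono) auto
        finally show ?thesis by simp
      qed
    qed
    finally show ?thesis by simp
  qed
  have "((\<lambda>y. ?E y - 1) \<longlongrightarrow> 0) at_top"
  proof (rule Lim_null_comparison)
    show "\<forall>\<^sub>F y in at_top. norm (?E y - 1) \<le> c * (\<integral>t. \<bar>t\<bar> \<partial>\<nu>) / y"
      using eventually_gt_at_top[of 0] by eventually_elim (rule bound)
    show "((\<lambda>y. c * (\<integral>t. \<bar>t\<bar> \<partial>\<nu>) / y) \<longlongrightarrow> 0) at_top"
      by (rule real_tendsto_divide_at_top[OF tendsto_const filterlim_ident])
  qed
  thus ?thesis by (simp add: LIM_zero_iff)
qed

section \<open>Pearson weights and their differential equation\<close>

lemma isCont_powr_shift: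
  assumes "Im z > 0"
  shows "isCont (\<lambda>t. (z - complex_of_real t) powr (- complex_of_real s)) t"
proof -
  have "continuous_on UNIV (\<lambda>t. (z - complex_of_real t) powr (- complex_of_real s))"
    by (intro continuous_intros) (use assms upper_half_not_nonpos in auto)
  thus ?thesis by (simp add: continuous_on_eq_continuous_at)
qed

text \<open>  \<open>p\<close> and \<open>q\<close> are the polynomials of the Pearson equation \<open>p w' = q w\<close>, and \<open>P\<close>, \<open>Q\<close> are the same
  polynomials on the complex plane. The constant \<open>k0\<close> is \<open>(1 + c) p''/2 + q'\<close>.\<close>

locale pearson =
  fixes p0 p1 p2 q0 q1 c :: real
  assumes c_pos: "c > 0"
begin

definition p :: "real \<Rightarrow> real" where "p x = p0 + p1 * x + p2 * x\<^sup>2"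
definition p' :: "real \<Rightarrow> real" where "p' x = p1 + 2 * p2 * x"
definition q :: "real \<Rightarrow> real" where "q x = q0 + q1 * x"
definition P :: "complex \<Rightarrow> complex" where "P z = of_real p0 + of_real p1 * z + of_real p2 * z\<^sup>2"
definition Q :: "complex \<Rightarrow> complex" where "Q z = of_real q0 + of_real q1 * z"
definition k0 :: real where "k0 = (1 + c) * p2 + q1"

text \<open>  Taylor expansion of \<open>P\<close> and \<open>Q\<close> at \<open>t\<close>. The left-hand side is what integration by parts produces,
  with coefficients depending on \<open>t\<close>; the right-hand side has coefficients depending on \<open>z\<close> only and
  therefore integrates to Stieltjes transforms. It also shows that the integrand is bounded, although
  the polynomials on the left are not.\<close>

lemma pearson_integrand_eq:
  assumes "Im z > 0"
  shows "of_real ((c + 1) * p t) * (z - complex_of_real t) powr (- complex_of_real (c + 2))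
      + of_real ((c + 1) * p' t + q t) * (z - complex_of_real t) powr (- complex_of_real (c + 1))
    = of_real (c + 1) * P z * (z - complex_of_real t) powr (- complex_of_real (c + 2))
      + Q z * (z - complex_of_real t) powr (- complex_of_real (c + 1))
      - of_real k0 * (z - complex_of_real t) powr (- complex_of_real c)"
proof -
  define w where "w = z - complex_of_real t"
  have w: "w \<noteq> 0" using assms by (auto simp: w_def complex_eq_iff)
  define b where "b = w powr (- complex_of_real (c + 2))"
  have b1: "w powr (- complex_of_real (c + 1)) = w * b"
  proof -
    have "w * b = w powr 1 * w powr (- complex_of_real (c + 2))" using w by (simp add: b_def)
    also have "\<dots> = w powr (1 + - complex_of_real (c + 2))" by (simp only: powr_add)
    finally show ?thesis by (simp add: algebra_simps)
  qed
  have b2: "w powr (- complex_of_real c) = w\<^sup>2 * b"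
  proof -
    have "w\<^sup>2 * b = w powr 2 * w powr (- complex_of_real (c + 2))" using w by (simp add: b_def)
    also have "\<dots> = w powr (2 + - complex_of_real (c + 2))" by (simp only: powr_add)
    finally show ?thesis by (simp add: algebra_simps)
  qed
  have z: "z = complex_of_real t + w" by (simp add: w_def)
  show ?thesis
    unfolding w_def[symmetric] b1 b2 b_def[symmetric]
    unfolding z P_def Q_def p_def p'_def q_def k0_def
    by (simp add: algebra_simps power2_eq_square)
qed

lemma integrable_pearson_integrand:
  assumes "real_distribution \<nu>" and z: "Im z > 0"
  shows "integrable \<nu> (\<lambda>t. of_real ((c + 1) * p t) * (z - complex_of_real t) powr (- complex_of_real (c + 2))
      + of_real ((c + 1) * p' t + q t) * (z - complex_of_real t) powr (- complex_of_real (c + 1)))"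
  unfolding pearson_integrand_eq[OF z]
  using integrable_powr_shift[OF assms, of c] integrable_powr_shift[OF assms, of "c + 1"]
    integrable_powr_shift[OF assms, of "c + 2"] c_pos
  by (intro Bochner_Integration.integrable_add Bochner_Integration.integrable_diff integrable_mult_right)
    (auto simp del: of_real_add)

text \<open>  The integrand times \<open>\<rho>\<close> is the derivative of \<open>p \<rho> (z - t)\<^sup>-\<^sup>c\<^sup>-\<^sup>1\<close>, which vanishes at both ends
  of the support.\<close>

lemma integral_pearson_integrand_eq_0:
  fixes l u :: ereal
  assumes \<nu>: "real_distribution \<nu>" and dens: "\<nu> = density lborel (\<lambda>t. ennreal (\<rho> t))"
    and \<rho>[measurable]: "\<rho> \<in> borel_measurable borel" and nonneg: "\<And>t. \<rho> t \<ge> 0"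
    and lu: "l < u" and supp: "\<And>t. \<not> (l < ereal t \<and> ereal t < u) \<Longrightarrow> \<rho> t = 0"
    and deriv: "\<And>t. l < ereal t \<Longrightarrow> ereal t < u \<Longrightarrow>
      ((\<lambda>t. p t * \<rho> t) has_real_derivative ((c + 1) * p' t + q t) * \<rho> t) (at t)"
    and cont: "\<And>t. l < ereal t \<Longrightarrow> ereal t < u \<Longrightarrow> isCont \<rho> t"
    and liml: "(((\<lambda>t. p t * \<rho> t) \<circ> real_of_ereal) \<longlongrightarrow> 0) (at_right l)"
    and limu: "(((\<lambda>t. p t * \<rho> t) \<circ> real_of_ereal) \<longlongrightarrow> 0) (at_left u)"
    and z: "Im z > 0"
  shows "(\<integral>t. of_real ((c + 1) * p t) * (z - complex_of_real t) powr (- complex_of_real (c + 2))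
      + of_real ((c + 1) * p' t + q t) * (z - complex_of_real t) powr (- complex_of_real (c + 1)) \<partial>\<nu>) = 0"
proof -
  let ?A = "\<lambda>t. of_real ((c + 1) * p t) * (z - complex_of_real t) powr (- complex_of_real (c + 2))
      + of_real ((c + 1) * p' t + q t) * (z - complex_of_real t) powr (- complex_of_real (c + 1))"
  let ?h = "\<lambda>t. (z - complex_of_real t) powr (- complex_of_real (c + 1))"
  have off: "z - complex_of_real t \<notin> \<real>\<^sub>\<le>\<^sub>0" for t
    using z upper_half_not_nonpos[of "z - complex_of_real t"] by simp
  have A: "?A \<in> borel_measurable borel"
    unfolding p_def p'_def q_def using borel_measurable_powr_shift[OF z] by measurable
  have intA: "integrable lborel (\<lambda>t. \<rho> t *\<^sub>R ?A t)"
    using integrable_pearson_integrand[OF \<nu> z] unfolding dens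
    by (subst (asm) integrable_density) (use A nonneg in auto)
  have ind: "indicator (einterval l u) t *\<^sub>R (\<rho> t *\<^sub>R ?A t) = \<rho> t *\<^sub>R ?A t" for t
    using supp[of t] by (auto simp: einterval_def indicator_def)
  have "(\<integral>t. ?A t \<partial>\<nu>) = (\<integral>t. \<rho> t *\<^sub>R ?A t \<partial>lborel)"
    unfolding dens by (rule integral_density) (use A nonneg in auto)
  also have "\<dots> = (LBINT t=l..u. \<rho> t *\<^sub>R ?A t)"
    using lu unfolding interval_lebesgue_integral_def set_lebesgue_integral_def ind by simp
  also have "\<dots> = 0 - 0"
  proof (rule interval_integral_FTC_integrable[where F = "\<lambda>t. (p t * \<rho> t) *\<^sub>R ?h t"])
    show "l < u" by fact
    show "((\<lambda>t. (p t * \<rho> t) *\<^sub>R ?h t) has_vector_derivative \<rho> t *\<^sub>R ?A t) (at t)"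
      if t: "l < ereal t" "ereal t < u" for t
    proof -
      have "((\<lambda>w. (z - w) powr (- complex_of_real (c + 1))) has_field_derivative
         of_real (c + 1) * (z - of_real t) powr (- complex_of_real (c + 2))) (at (of_real t))"
      proof -
        let ?s = "- complex_of_real (c + 1)"
        have "((\<lambda>w. (z - w) powr ?s) has_field_derivative
            ?s * (z - of_real t) powr (?s - 1) * (0 - 1)) (at (of_real t))"
          using off[of t] by (auto intro!: derivative_eq_intros)
        moreover have "?s - 1 = - complex_of_real (c + 2)" by (simp add: algebra_simps)
        moreover have "?s * Y * (0 - 1) = of_real (c + 1) * Y" for Y by (simp add: algebra_simps)
        ultimately show ?thesis by (simp only:)
      qed
      hence "(?h has_vector_derivative
         of_real (c + 1) * (z - of_real t) powr (- complex_of_real (c + 2))) (at t)"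
        by (rule has_vector_derivative_real_field)
      from has_vector_derivative_scaleR[OF deriv[OF t] this] show ?thesis
        by (rule has_vector_derivative_eq_rhs) (simp add: scaleR_conv_of_real algebra_simps)
    qed
    show "isCont (\<lambda>t. \<rho> t *\<^sub>R ?A t) t" if t: "l < ereal t" "ereal t < u" for t
    proof -
      have "isCont (\<lambda>t. complex_of_real ((c + 1) * p t)) t"
        "isCont (\<lambda>t. complex_of_real ((c + 1) * p' t + q t)) t"
        unfolding p_def p'_def q_def by (intro continuous_intros)+
      thus ?thesis
        by (intro continuous_scaleR continuous_add continuous_mult isCont_powr_shift[OF z] cont[OF t])
    qed
    show "set_integrable lborel (einterval l u) (\<lambda>t. \<rho> t *\<^sub>R ?A t)"
      unfolding set_integrable_def ind by (rule intA)
    have lim: "(((\<lambda>t. (p t * \<rho> t) *\<^sub>R ?h t) \<circ> real_of_ereal) \<longlongrightarrow> 0) F"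
      if "(((\<lambda>t. p t * \<rho> t) \<circ> real_of_ereal) \<longlongrightarrow> 0) F" for F :: "ereal filter"
    proof (rule Lim_null_comparison)
      show "((\<lambda>e. \<bar>((\<lambda>t. p t * \<rho> t) \<circ> real_of_ereal) e\<bar> * Im z powr (- (c + 1))) \<longlongrightarrow> 0) F"
        by (rule tendsto_mult_left_zero[OF tendsto_rabs_zero[OF that]])
      show "\<forall>\<^sub>F e in F. norm (((\<lambda>t. (p t * \<rho> t) *\<^sub>R ?h t) \<circ> real_of_ereal) e)
          \<le> \<bar>((\<lambda>t. p t * \<rho> t) \<circ> real_of_ereal) e\<bar> * Im z powr (- (c + 1))"
        using norm_powr_minus_le[OF z, of "c + 1"] c_pos
        by (intro always_eventually) (auto simp: abs_mult intro!: mult_left_mono simp del: of_real_add)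
    qed
    show "(((\<lambda>t. (p t * \<rho> t) *\<^sub>R ?h t) \<circ> real_of_ereal) \<longlongrightarrow> 0) (at_right l)" by (rule lim[OF liml])
    show "(((\<lambda>t. (p t * \<rho> t) *\<^sub>R ?h t) \<circ> real_of_ereal) \<longlongrightarrow> 0) (at_left u)" by (rule lim[OF limu])
  qed
  finally show ?thesis by simp
qed

lemma stieltjes_ode:
  assumes \<nu>: "real_distribution \<nu>" and z: "Im z > 0"
    and eq0: "(\<integral>t. of_real ((c + 1) * p t) * (z - complex_of_real t) powr (- complex_of_real (c + 2))
      + of_real ((c + 1) * p' t + q t) * (z - complex_of_real t) powr (- complex_of_real (c + 1)) \<partial>\<nu>) = 0"
  shows "of_real (c + 1) * P z * stieltjes (c + 2) \<nu> z + Q z * stieltjes (c + 1) \<nu> z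
    = of_real k0 * stieltjes c \<nu> z"
proof -
  have i: "integrable \<nu> (\<lambda>t. (z - complex_of_real t) powr (- complex_of_real s))" if "s \<ge> 0" for s
    by (rule integrable_powr_shift[OF \<nu> z that])
  note i = i[of c] i[of "c + 1"] i[of "c + 2"]
  show ?thesis
    using eq0 c_pos i unfolding pearson_integrand_eq[OF z] stieltjes_def
    by (simp del: of_real_add)
qed

text \<open>  The assumption \<open>growth\<close> says that the continuation \<open>exp V\<close> of the weight decays at most like
  \<open>y\<^sup>-\<^sup>2\<close> on the imaginary axis. For the Jacobi weight it behaves like \<open>y\<^sup>a\<^sup>+\<^sup>b\<close> with \<open>a + b > -2\<close>,
  so no smaller exponent would cover all parameters.\<close>

theorem markov_krein_upper_half_plane:
  assumes \<mu>: "real_distribution \<mu>" and m\<mu>: "integrable \<mu> (\<lambda>u. u)"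
    and \<nu>: "real_distribution \<nu>" and m\<nu>: "integrable \<nu> (\<lambda>t. t)"
    and riccati: "\<And>z. Im z > 0 \<Longrightarrow>
      P z * (of_real c * (stieltjes 1 \<mu> z)\<^sup>2 + stieltjes 2 \<mu> z) + Q z * stieltjes 1 \<mu> z = of_real k0"
    and ode: "\<And>z. Im z > 0 \<Longrightarrow>
      of_real (c + 1) * P z * stieltjes (c + 2) \<nu> z + Q z * stieltjes (c + 1) \<nu> z = of_real k0 * stieltjes c \<nu> z"
    and P: "\<And>z. Im z > 0 \<Longrightarrow> P z \<noteq> 0"
    and V: "\<And>z. Im z > 0 \<Longrightarrow> (V has_field_derivative Q z / P z) (at z)"
    and growth: "\<And>y. y \<ge> 1 \<Longrightarrow> Re (V (\<i> * of_real y)) \<ge> - 2 * ln y - K"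
    and z: "Im z > 0"
  shows "stieltjes c \<nu> z = exp (- of_real c * log_potential \<mu> z)"
proof -
  let ?S = "stieltjes 1 \<mu>" and ?G = "stieltjes c \<nu>" and ?G1 = "stieltjes (c + 1) \<nu>"
  define F where "F = (\<lambda>z. exp (- of_real c * log_potential \<mu> z))"
  have F: "(F has_field_derivative - of_real c * ?S z * F z) (at z)" if "Im z > 0" for z
    unfolding F_def using has_field_derivative_log_potential[OF \<mu> m\<mu> that]
    by (auto intro!: derivative_eq_intros)
  have S: "(?S has_field_derivative - stieltjes 2 \<mu> z) (at z)" if "Im z > 0" for z
    using has_field_derivative_stieltjes[OF \<mu> _ that, of 1] by simp
  have F': "((\<lambda>z. - of_real c * ?S z * F z) has_field_derivative
      of_real c * (of_real c * (?S z)\<^sup>2 + stieltjes 2 \<mu> z) * F z) (at z)" if "Im z > 0" for z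
    using F[OF that] S[OF that]
    by (auto intro!: derivative_eq_intros simp: algebra_simps power2_eq_square)
  have G: "(?G has_field_derivative - of_real c * ?G1 z) (at z)" if "Im z > 0" for z
    using has_field_derivative_stieltjes[OF \<nu> c_pos that] .
  have G': "((\<lambda>z. - of_real c * ?G1 z) has_field_derivative
      of_real c * of_real (c + 1) * stieltjes (c + 2) \<nu> z) (at z)" if "Im z > 0" for z
    using has_field_derivative_stieltjes[OF \<nu> _ that, of "c + 1"] c_pos
    by (auto intro!: derivative_eq_intros simp: algebra_simps)
  have "\<exists>a. \<forall>z. Im z > 0 \<longrightarrow> ?G z = a * F z"
  proof (rule second_order_solutions_proportional[OF F F' G G', where p = P and q = Q
        and k = "of_real (c * k0)" and V = V and V' = "\<lambda>z. Q z / P z"])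
    fix z assume z: "Im z > 0"
    show "P z * (of_real c * (of_real c * (?S z)\<^sup>2 + stieltjes 2 \<mu> z) * F z)
        = Q z * (- of_real c * ?S z * F z) + of_real (c * k0) * F z"
    proof -
      have "P z * (of_real c * (of_real c * (?S z)\<^sup>2 + stieltjes 2 \<mu> z) * F z)
         = of_real c * F z * (P z * (of_real c * (?S z)\<^sup>2 + stieltjes 2 \<mu> z))" by (simp add: algebra_simps)
      also have "P z * (of_real c * (?S z)\<^sup>2 + stieltjes 2 \<mu> z) = of_real k0 - Q z * ?S z"
        using riccati[OF z] by (simp add: algebra_simps)
      finally show ?thesis by (simp add: algebra_simps)
    qed
    show "P z * (of_real c * of_real (c + 1) * stieltjes (c + 2) \<nu> z)
        = Q z * (- of_real c * ?G1 z) + of_real (c * k0) * ?G z"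
    proof -
      have "P z * (of_real c * of_real (c + 1) * stieltjes (c + 2) \<nu> z)
         = of_real c * (of_real (c + 1) * P z * stieltjes (c + 2) \<nu> z)" by (simp add: algebra_simps)
      also have "of_real (c + 1) * P z * stieltjes (c + 2) \<nu> z = of_real k0 * ?G z - Q z * ?G1 z"
        using ode[OF z] by (simp add: algebra_simps)
      finally show ?thesis by (simp add: algebra_simps)
    qed
    show "(V has_field_derivative Q z / P z) (at z)" by (rule V[OF z])
    show "P z * (Q z / P z) = Q z" using P[OF z] by simp
    show "P z \<noteq> 0" by (rule P[OF z])
    show "F z \<noteq> 0" by (simp add: F_def)
  next
    let ?m = "\<integral>u. \<bar>u\<bar> \<partial>\<mu>" and ?m' = "\<integral>t. \<bar>t\<bar> \<partial>\<nu>"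
    define C where "C = c * (?m + ?m') * exp K"
    show "((\<lambda>y. (- of_real c * ?S (\<i> * of_real y) * F (\<i> * of_real y) * ?G (\<i> * of_real y)
          - F (\<i> * of_real y) * (- of_real c * ?G1 (\<i> * of_real y)))
        * exp (- V (\<i> * of_real y))) \<longlongrightarrow> 0) at_top"
    proof (rule Lim_null_comparison)
      have "((\<lambda>y::real. y powr (- (2 * c))) \<longlongrightarrow> 0) at_top"
        by (rule tendsto_neg_powr[OF _ filterlim_ident]) (use c_pos in simp)
      thus "((\<lambda>y::real. C * y powr (- (2 * c))) \<longlongrightarrow> 0) at_top"
        by (rule tendsto_mult_right_zero)
      show "\<forall>\<^sub>F y in at_top. norm ((- of_real c * ?S (\<i> * of_real y) * F (\<i> * of_real y) * ?G (\<i> * of_real y)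
          - F (\<i> * of_real y) * (- of_real c * ?G1 (\<i> * of_real y)))
          * exp (- V (\<i> * of_real y))) \<le> C * y powr (- (2 * c))"
        using eventually_ge_at_top[of 1]
      proof eventually_elim
        case (elim y)
        hence y: "y > 0" by simp
        let ?z = "\<i> * complex_of_real y"
        let ?W = "- of_real c * ?S ?z * F ?z * ?G ?z - F ?z * (- of_real c * ?G1 ?z)"
        have "(?z - complex_of_real t) powr 0 = 1" for t
          using y by (auto simp: complex_eq_iff)
        hence S0: "stieltjes 0 \<mu> ?z = 1"
          using real_distribution.space_eq_univ[OF \<mu>] prob_space.prob_space[of \<mu>] \<mu>
          unfolding stieltjes_def real_distribution_def by simp
        have a1: "norm (1 - ?z * ?S ?z) \<le> ?m / y"
          using norm_stieltjes_euler_le[OF \<mu> m\<mu> y, of 0] y by (simp add: S0 powr_minus_divide)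
        have a2: "norm (?G ?z - ?z * ?G1 ?z) \<le> y powr (- c) / y * ?m'"
          using norm_stieltjes_euler_le[OF \<nu> m\<nu> y, of c] c_pos y by (simp add: powr_diff)
        have a3: "norm (F ?z) \<le> y powr (- c)"
          unfolding F_def using norm_exp_log_potential_le[OF \<mu> m\<mu> y] c_pos by simp
        have a4: "norm (?G ?z) \<le> y powr (- c)" using norm_stieltjes_le[OF \<nu> y] c_pos by simp
        have m: "?m \<ge> 0" by simp
        \<comment> \<open>the Wronskian in terms of two differences that are small by \<open>norm_stieltjes_euler_le\<close>\<close>
        have "?z * ?W = of_real c * F ?z * ((1 - ?z * ?S ?z) * ?G ?z - (?G ?z - ?z * ?G1 ?z))"
          by (simp add: algebra_simps)
        hence "y * norm ?W = c * norm (F ?z) * norm ((1 - ?z * ?S ?z) * ?G ?z - (?G ?z - ?z * ?G1 ?z))"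
          using c_pos y by (metis (no_types, opaque_lifting) norm_mult norm_of_real abs_of_pos norm_ii mult_1)
        also have "\<dots> \<le> c * y powr (- c) * (?m / y * y powr (- c) + y powr (- c) / y * ?m')"
        proof -
          have "norm ((1 - ?z * ?S ?z) * ?G ?z) \<le> ?m / y * y powr (- c)"
            unfolding norm_mult[of "1 - ?z * ?S ?z"] using a1 a4 m y by (intro mult_mono) auto
          hence "norm ((1 - ?z * ?S ?z) * ?G ?z - (?G ?z - ?z * ?G1 ?z))
              \<le> ?m / y * y powr (- c) + y powr (- c) / y * ?m'"
            using a2 norm_triangle_ineq4[of "(1 - ?z * ?S ?z) * ?G ?z" "?G ?z - ?z * ?G1 ?z"] by linarith
          thus ?thesis using a3 c_pos by (intro mult_mono) auto
        qed
        also have "\<dots> = c * (?m + ?m') * (y powr (- c) * y powr (- c)) / y"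
          using y by (simp add: field_simps)
        also have "y powr (- c) * y powr (- c) = y powr (- (2 * c))" by (simp add: powr_add[symmetric])
        finally have W: "norm ?W \<le> c * (?m + ?m') * y powr (- (2 * c)) / y\<^sup>2"
          using y by (simp add: field_simps power2_eq_square)
        have "norm (exp (- V ?z)) \<le> exp (2 * ln y + K)"
          using growth[OF elim] by (simp add: norm_exp_eq_Re)
        also have "\<dots> = y\<^sup>2 * exp K"
          using y by (simp add: exp_add exp_double power2_eq_square)
        finally have eV: "norm (exp (- V ?z)) \<le> y\<^sup>2 * exp K" .
        have "norm (?W * exp (- V ?z)) \<le>
            (c * (?m + ?m') * y powr (- (2 * c)) / y\<^sup>2) * (y\<^sup>2 * exp K)"
          unfolding norm_mult[of ?W]
          by (rule mult_mono[OF W eV order.trans[OF norm_ge_zero W] norm_ge_zero])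
        also have "\<dots> = C * y powr (- (2 * c))" using y by (simp add: C_def)
        finally show ?case .
      qed
    qed
  qed
  then obtain a where a: "\<And>z. Im z > 0 \<Longrightarrow> ?G z = a * F z" by blast
  let ?E = "\<lambda>y. exp (of_real c * Ln (\<i> * complex_of_real y))"
  have "((\<lambda>y. a * (?E y * F (\<i> * of_real y))) \<longlongrightarrow> a * 1) at_top"
    unfolding F_def by (intro tendsto_mult_left tendsto_exp_log_potential_normalized[OF \<mu> m\<mu>])
  moreover have "((\<lambda>y. a * (?E y * F (\<i> * of_real y))) \<longlongrightarrow> 1) at_top"
  proof (rule Lim_transform_eventually)
    show "((\<lambda>y. ?E y * ?G (\<i> * of_real y)) \<longlongrightarrow> 1) at_top"
      using tendsto_stieltjes_normalized[OF \<nu> m\<nu>, of c] c_pos by simp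
    show "\<forall>\<^sub>F y in at_top. ?E y * ?G (\<i> * of_real y) = a * (?E y * F (\<i> * of_real y))"
      using eventually_gt_at_top[of 0] by eventually_elim (simp add: a)
  qed
  ultimately have "a * 1 = 1" by (rule tendsto_unique[OF trivial_limit_at_top_linorder])
  hence "a = 1" by simp
  with a[OF z] show ?thesis by (simp add: F_def)
qed

end

section \<open>Perturbation of high temperature ensembles\<close>

text \<open>  The logarithmic gain of the density splits into a pair term \<open>e\<close>, the gain \<open>\<psi>\<close> of the weight and
  the gain \<open>\<xi>\<close> of the Jacobian, which can be estimated independently.\<close>

lemma beta_ensemble_weight_mono_transport:
  assumes \<beta>: "\<beta> \<ge> 0" and w: "\<And>x. w x \<ge> 0"
    and e: "\<And>x y. exp (e x y) * \<bar>x - y\<bar> \<le> \<bar>\<phi> x - \<phi> y\<bar>"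
    and \<psi>: "\<And>x. w x * exp (\<psi> x) \<le> w (\<phi> x)"
    and \<xi>: "\<And>x. exp (\<xi> x) \<le> \<phi>' x"
  shows "beta_ensemble_weight \<beta> w N x *
      exp (\<beta> * (\<Sum>j<N. \<Sum>i<j. e (x j) (x i)) + (\<Sum>l<N. \<psi> (x l) + \<xi> (x l)))
    \<le> beta_ensemble_weight \<beta> w N (\<lambda>i. \<phi> (x i)) * (\<Prod>l<N. \<phi>' (x l))"
proof -
  have "exp (\<beta> * (\<Sum>j<N. \<Sum>i<j. e (x j) (x i)))
      = (\<Prod>j<N. \<Prod>i<j. exp (\<beta> * e (x j) (x i)))"
    by (simp add: exp_sum sum_distrib_left)
  hence "beta_ensemble_weight \<beta> w N x *
      exp (\<beta> * (\<Sum>j<N. \<Sum>i<j. e (x j) (x i)) + (\<Sum>l<N. \<psi> (x l) + \<xi> (x l)))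
    = (\<Prod>j<N. \<Prod>i<j. \<bar>x j - x i\<bar> powr \<beta> * exp (\<beta> * e (x j) (x i)))
        * (\<Prod>l<N. w (x l) * exp (\<psi> (x l))) * (\<Prod>l<N. exp (\<xi> (x l)))"
    unfolding beta_ensemble_weight_def
    by (simp add: exp_add exp_sum sum.distrib prod.distrib mult_ac)
  also have "\<dots> \<le> (\<Prod>j<N. \<Prod>i<j. \<bar>\<phi> (x j) - \<phi> (x i)\<bar> powr \<beta>)
        * (\<Prod>l<N. w (\<phi> (x l))) * (\<Prod>l<N. \<phi>' (x l))"
  proof (intro mult_mono prod_mono prod_nonneg mult_nonneg_nonneg conjI ballI)
    fix j i
    have "\<bar>x j - x i\<bar> powr \<beta> * exp (\<beta> * e (x j) (x i))
        = (exp (e (x j) (x i)) * \<bar>x j - x i\<bar>) powr \<beta>"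
      by (simp add: powr_mult exp_powr_real mult_ac)
    also have "\<dots> \<le> \<bar>\<phi> (x j) - \<phi> (x i)\<bar> powr \<beta>"
      using e \<beta> by (intro powr_mono2) auto
    finally show "\<bar>x j - x i\<bar> powr \<beta> * exp (\<beta> * e (x j) (x i)) \<le> \<bar>\<phi> (x j) - \<phi> (x i)\<bar> powr \<beta>" .
  qed (use w \<psi> \<xi> in auto)
  finally show ?thesis by (simp add: beta_ensemble_weight_def)
qed

text \<open>  \<open>T N\<close> is a lower bound for the gain in free energy per particle when all particles are moved by
  \<open>\<phi>\<close>. In the limit no movement can have a positive gain.\<close>

lemma high_temperature_rate_nonpos:
  fixes \<phi> \<phi>' :: "real \<Rightarrow> real" and T :: "nat \<Rightarrow> (nat \<Rightarrow> real) \<Rightarrow> real"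
  assumes htl: "high_temperature_limit \<Omega> X c w \<mu>" and c: "c \<ge> 0" and w: "\<And>x. w x \<ge> 0"
    and deriv: "\<And>x. (\<phi> has_real_derivative \<phi>' x) (at x)" and cont: "continuous_on UNIV \<phi>'"
    and e: "\<And>x y. exp (e x y) * \<bar>x - y\<bar> \<le> \<bar>\<phi> x - \<phi> y\<bar>"
    and \<psi>: "\<And>x. w x * exp (\<psi> x) \<le> w (\<phi> x)"
    and \<xi>: "\<And>x. exp (\<xi> x) \<le> \<phi>' x"
    and meas: "\<And>N. T N \<in> borel_measurable (\<Pi>\<^sub>M i\<in>{..<N}. lborel)"
    and T: "\<And>N x. N \<ge> 1 \<Longrightarrow> real N * T N x
      \<le> 2 * c / real N * (\<Sum>j<N. \<Sum>i<j. e (x j) (x i)) + (\<Sum>l<N. \<psi> (x l) + \<xi> (x l))"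
    and lim: "AE \<omega> in \<Omega>. (\<lambda>N. T (Suc N) (\<lambda>i\<in>{..<Suc N}. X (Suc N) i \<omega>)) \<longlonglongrightarrow> \<tau>"
  shows "\<tau> \<le> 0"
proof (rule exponential_rate_nonpos[OF _ _ _ lim])
  show \<Omega>: "prob_space \<Omega>" using htl by (simp add: high_temperature_limit_def)
  fix N
  let ?N = "Suc N"
  have ens: "beta_ensemble \<Omega> (2 * c / real ?N) w ?N (X ?N)"
  proof -
    from htl have "\<forall>N\<ge>1. beta_ensemble \<Omega> (2 * c / real N) w N (X N)"
      by (simp add: high_temperature_limit_def)
    from this[rule_format, of ?N] show ?thesis by simp
  qed
  then obtain C where "distributed \<Omega> (\<Pi>\<^sub>M i\<in>{..<?N}. lborel) (\<lambda>\<omega>. \<lambda>i\<in>{..<?N}. X ?N i \<omega>)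
      (\<lambda>x. ennreal (C * beta_ensemble_weight (2 * c / real ?N) w ?N x))"
    unfolding beta_ensemble_def by auto
  hence "(\<lambda>\<omega>. \<lambda>i\<in>{..<?N}. X ?N i \<omega>) \<in> measurable \<Omega> (\<Pi>\<^sub>M i\<in>{..<?N}. lborel)"
    by (rule distributed_measurable)
  from measurable_compose[OF this meas]
  show "(\<lambda>\<omega>. T ?N (\<lambda>i\<in>{..<?N}. X ?N i \<omega>)) \<in> borel_measurable \<Omega>" .
  show "(\<integral>\<^sup>+\<omega>. ennreal (exp (real ?N * T ?N (\<lambda>i\<in>{..<?N}. X ?N i \<omega>))) \<partial>\<Omega>) \<le> 1"
  proof (rule beta_ensemble_transport[OF \<Omega> ens w deriv cont, where R = "\<lambda>x. real ?N * T ?N x"])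
    show "\<phi>' x \<ge> 0" for x using \<xi>[of x] exp_gt_zero[of "\<xi> x"] by linarith
    show "(\<lambda>x. real ?N * T ?N x) \<in> borel_measurable (\<Pi>\<^sub>M i\<in>{..<?N}. lborel)"
      using meas by (intro borel_measurable_times) auto
    fix x
    have "beta_ensemble_weight (2 * c / real ?N) w ?N x * exp (real ?N * T ?N x)
      \<le> beta_ensemble_weight (2 * c / real ?N) w ?N x *
        exp (2 * c / real ?N * (\<Sum>j<?N. \<Sum>i<j. e (x j) (x i)) + (\<Sum>l<?N. \<psi> (x l) + \<xi> (x l)))"
      using T[of ?N x] by (intro mult_left_mono beta_ensemble_weight_nonneg w) auto
    also have "\<dots> \<le> beta_ensemble_weight (2 * c / real ?N) w ?N (\<lambda>i. \<phi> (x i)) * (\<Prod>l<?N. \<phi>' (x l))"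
      by (rule beta_ensemble_weight_mono_transport[where e = e and \<psi> = \<psi> and \<xi> = \<xi>])
        (use c w e \<psi> \<xi> in auto)
    finally show "beta_ensemble_weight (2 * c / real ?N) w ?N x * exp (real ?N * T ?N x)
      \<le> beta_ensemble_weight (2 * c / real ?N) w ?N (\<lambda>i. \<phi> (x i)) * (\<Prod>l<?N. \<phi>' (x l))" .
  qed
qed

lemma integral_empirical_distribution:
  fixes f :: "real \<Rightarrow> 'b::{banach, second_countable_topology}"
  assumes "f \<in> borel_measurable borel"
  shows "(\<integral>x. f x \<partial>empirical_distribution N x) = (\<Sum>i<N. f (x i)) /\<^sub>R real N"
proof -
  have "(\<integral>x. f x \<partial>empirical_distribution N x) = (\<integral>i. f (x i) \<partial>uniform_count_measure {..<N})"
    unfolding empirical_distribution_def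
    by (rule integral_distr) (use assms in \<open>auto simp: measurable_def
        space_uniform_count_measure sets_uniform_count_measure\<close>)
  also have "\<dots> = (\<Sum>i<N. f (x i)) /\<^sub>R real N"
    by (simp add: uniform_count_measure_def lebesgue_integral_point_measure_finite
        scaleR_sum_right inverse_eq_divide)
  finally show ?thesis .
qed

lemma real_distribution_empirical:
  assumes "N \<ge> 1"
  shows "real_distribution (empirical_distribution N x)"
proof -
  have "prob_space (uniform_count_measure {..<N})"
    using assms by (intro prob_space_uniform_count_measure) (auto simp: lessThan_empty_iff)
  then interpret prob_space "uniform_count_measure {..<N}" .
  show ?thesis unfolding empirical_distribution_def
    by (intro real_distribution_distr) (auto simp: measurable_def
        space_uniform_count_measure sets_uniform_count_measure)
qed

lemma high_temperature_limit_integral: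
  fixes f :: "real \<Rightarrow> 'b::{banach, second_countable_topology}"
  assumes htl: "high_temperature_limit \<Omega> X c w \<mu>"
    and cont: "\<And>x. isCont f x" and bdd: "\<And>x. norm (f x) \<le> B"
  shows "AE \<omega> in \<Omega>. (\<lambda>N. (\<Sum>i<Suc N. f (X (Suc N) i \<omega>)) /\<^sub>R real (Suc N)) \<longlonglongrightarrow> (\<integral>x. f x \<partial>\<mu>)"
proof -
  have conv: "AE \<omega> in \<Omega>. weak_conv_m (\<lambda>N. empirical_distribution N (\<lambda>i. X N i \<omega>)) \<mu>"
    and \<mu>: "real_distribution \<mu>"
    using htl by (auto simp: high_temperature_limit_def)
  from conv show ?thesis
  proof eventually_elim
    case (elim \<omega>)
    have "weak_conv_m (\<lambda>N. empirical_distribution (Suc N) (\<lambda>i. X (Suc N) i \<omega>)) \<mu>"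
      using elim unfolding weak_conv_m_def weak_conv_def by (auto intro: LIMSEQ_Suc)
    from weak_conv_imp_integral_bdd_continuous_conv[OF _ \<mu> this cont bdd]
    have "(\<lambda>N. \<integral>x. f x \<partial>empirical_distribution (Suc N) (\<lambda>i. X (Suc N) i \<omega>)) \<longlonglongrightarrow> (\<integral>x. f x \<partial>\<mu>)"
      by (simp add: real_distribution_empirical)
    moreover have "f \<in> borel_measurable borel"
      using cont by (intro borel_measurable_continuous_onI continuous_at_imp_continuous_on) auto
    ultimately show ?case by (simp add: integral_empirical_distribution del: of_nat_Suc)
  qed
qed

lemma sum_ordered_pairs:
  fixes d :: "nat \<Rightarrow> nat \<Rightarrow> real"
  assumes sym: "\<And>i j. d i j = d j i"
  shows "(\<Sum>j<N. \<Sum>i<j. d j i) = ((\<Sum>j<N. \<Sum>i<N. d j i) - (\<Sum>j<N. d j j)) / 2"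
proof (induction N)
  case (Suc N)
  have "(\<Sum>j<N. d j N) = (\<Sum>i<N. d N i)" by (intro sum.cong refl sym)
  with Suc show ?case by (simp add: sum.distrib field_simps)
qed simp

section \<open>The loop equation\<close>

lemma linear_le_quadratic_imp_zero:
  fixes a :: real
  assumes "\<delta> > 0" and le: "\<And>\<epsilon>. \<bar>\<epsilon>\<bar> < \<delta> \<Longrightarrow> \<epsilon> * a \<le> K * \<epsilon>\<^sup>2"
  shows "a = 0"
proof (rule ccontr)
  assume a: "a \<noteq> 0"
  define t where "t = min (\<delta> / 2) (\<bar>a\<bar> / (2 * (\<bar>K\<bar> + 1)))"
  have t: "t > 0" "t < \<delta>" "t \<le> \<bar>a\<bar> / (2 * (\<bar>K\<bar> + 1))" using a assms by (auto simp: t_def)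
  have "sgn a * t * a \<le> K * (sgn a * t)\<^sup>2" using t a by (intro le) (auto simp: abs_mult)
  also have "(sgn a * t)\<^sup>2 = t\<^sup>2" using a by (simp add: power_mult_distrib sgn_if)
  also have "sgn a * t * a = t * \<bar>a\<bar>" by (simp add: abs_sgn mult_ac)
  finally have "\<bar>a\<bar> \<le> K * t" using t(1) by (simp add: power2_eq_square)
  also have "\<dots> \<le> (\<bar>K\<bar> + 1) * t" using t(1) by (intro mult_right_mono) auto
  also have "\<dots> \<le> (\<bar>K\<bar> + 1) * (\<bar>a\<bar> / (2 * (\<bar>K\<bar> + 1)))" using t(3) by (intro mult_left_mono) auto
  also have "\<dots> = \<bar>a\<bar> / 2" by (simp add: field_simps add_nonneg_eq_0_iff)
  finally show False using a by simp
qed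

lemma Re_of_real_mult: "Re (of_real r * w) = r * Re w"
  by simp

context pearson
begin

text \<open>  The displacement \<open>p g\<close> with \<open>g x = Re (\<kappa> / (z - x))\<close> has bounded divided differences, since \<open>p\<close>
  has degree at most two. Its first-order gain, as a function of the empirical distribution, is
  the real part of \<open>\<kappa>\<close> times the defect of the Riccati equation: divided differences of
  \<open>1 / (z - x)\<close> factorise, so the double sum over pairs is the square of a Cauchy transform and only
  one-particle averages have to converge. The freedom in \<open>\<kappa>\<close> recovers the complex equation.

  The factor \<open>p\<close> makes the displacement vanish at the finite end points of the support, and
  \<open>perturb\<close> is the second-order bound on the logarithmic change of the weight.\<close>

lemma loop_equation:
  assumes htl: "high_temperature_limit \<Omega> X c w \<mu>" and w: "\<And>x. w x \<ge> 0"
    and perturb: "\<And>\<kappa>. \<exists>K \<delta>. \<delta> > 0 \<and> (\<forall>\<epsilon> x. \<bar>\<epsilon>\<bar> < \<delta> \<longrightarrow>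
      w x * exp (\<epsilon> * (q x * Re (\<kappa> / (z - of_real x))) - K * \<epsilon>\<^sup>2)
        \<le> w (x + \<epsilon> * (p x * Re (\<kappa> / (z - of_real x)))))"
    and z: "Im z > 0"
  shows "P z * (of_real c * (stieltjes 1 \<mu> z)\<^sup>2 + stieltjes 2 \<mu> z) + Q z * stieltjes 1 \<mu> z = of_real k0"
proof -
  define s where "s = (\<lambda>x. 1 / (z - complex_of_real x))"
  have nz: "z - complex_of_real x \<noteq> 0" for x using z by (auto simp: complex_eq_iff)
  have isCont_s: "isCont s x" for x
    unfolding s_def using nz[of x] by (intro continuous_intros)
  have norm_s: "norm (s x) \<le> 1 / Im z" for x
  proof -
    have "Im z \<le> norm (z - complex_of_real x)"
      using abs_Im_le_cmod[of "z - complex_of_real x"] z by simp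
    thus ?thesis using z by (simp add: s_def norm_divide frac_le)
  qed
  have s_diff: "s x - s y = of_real (x - y) * (s x * s y)" for x y
    using nz[of x] nz[of y] by (simp add: s_def field_simps)
  have ps: "of_real (p x) * s x = P z * s x - (of_real p1 + of_real p2 * (z + of_real x))" for x
    using nz[of x] unfolding s_def p_def P_def by (simp add: field_simps power2_eq_square)
  have qs: "of_real (q x) * s x = Q z * s x - of_real q1" for x
    using nz[of x] unfolding s_def q_def Q_def by (simp add: field_simps)
  define S1 where "S1 = stieltjes 1 \<mu> z"
  define S2 where "S2 = stieltjes 2 \<mu> z"
  define Z where "Z = (\<lambda>\<sigma>1 \<sigma>2. P z * (of_real c * \<sigma>1\<^sup>2 + \<sigma>2) + Q z * \<sigma>1 - of_real k0)"
  define \<sigma>1 where "\<sigma>1 = (\<lambda>N x. (\<Sum>i<N. s (x i)) /\<^sub>R real N)"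
  define \<sigma>2 where "\<sigma>2 = (\<lambda>N x. (\<Sum>i<N. (s (x i))\<^sup>2) /\<^sub>R real N)"
  have lim1: "AE \<omega> in \<Omega>. (\<lambda>N. \<sigma>1 (Suc N) (\<lambda>i. X (Suc N) i \<omega>)) \<longlonglongrightarrow> S1"
    unfolding \<sigma>1_def S1_def stieltjes_1[OF z]
    using high_temperature_limit_integral[OF htl isCont_s norm_s] by (simp add: s_def)
  have lim2: "AE \<omega> in \<Omega>. (\<lambda>N. \<sigma>2 (Suc N) (\<lambda>i. X (Suc N) i \<omega>)) \<longlonglongrightarrow> S2"
  proof -
    have "norm ((s x)\<^sup>2) \<le> (1 / Im z)\<^sup>2" for x
      unfolding norm_power using norm_s by (intro power_mono) auto
    moreover have "isCont (\<lambda>x. (s x)\<^sup>2) x" for x by (intro continuous_intros isCont_s)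
    ultimately show ?thesis
      using high_temperature_limit_integral[OF htl, of "\<lambda>x. (s x)\<^sup>2" "(1 / Im z)\<^sup>2"]
      unfolding \<sigma>2_def S2_def stieltjes_2[OF z] by (simp add: s_def power_divide)
  qed
  have "Re (\<kappa> * Z S1 S2) = 0" for \<kappa>
  proof -
    define g where "g = (\<lambda>x. Re (\<kappa> * s x))"
    \<comment> \<open>the divided difference of the displacement, whose diagonal is its derivative\<close>
    define d where "d = (\<lambda>x y. Re (\<kappa> * (P z * (s x * s y) - of_real p2)))"
    define B where "B = norm \<kappa> * (norm (P z) * (1 / Im z * (1 / Im z)) + \<bar>p2\<bar>)"
    have B0: "B \<ge> 0" using z by (auto simp: B_def intro!: mult_nonneg_nonneg add_nonneg_nonneg)
    have dB: "\<bar>d x y\<bar> \<le> B" for x y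
    proof -
      have "\<bar>d x y\<bar> \<le> norm \<kappa> * norm (P z * (s x * s y) - of_real p2)"
        unfolding d_def norm_mult[symmetric] by (rule abs_Re_le_cmod)
      also have "norm (P z * (s x * s y) - of_real p2) \<le> norm (P z) * (norm (s x) * norm (s y)) + \<bar>p2\<bar>"
        using norm_triangle_ineq4[of "P z * (s x * s y)" "of_real p2"] by (simp add: norm_mult)
      also have "norm (s x) * norm (s y) \<le> 1 / Im z * (1 / Im z)"
        using norm_s z by (intro mult_mono) auto
      finally show ?thesis by (simp add: B_def mult_left_mono add_mono)
    qed
    have d_sym: "d x y = d y x" for x y by (simp only: d_def mult.commute[of "s x" "s y"])
    have pg_diff: "p x * g x - p y * g y = d x y * (x - y)" for x y
    proof -
      have "p x * g x - p y * g y = Re (\<kappa> * (of_real (p x) * s x - of_real (p y) * s y))"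
        by (simp add: g_def algebra_simps)
      also have "of_real (p x) * s x - of_real (p y) * s y = P z * (s x - s y) - of_real p2 * of_real (x - y)"
        unfolding ps by (simp add: algebra_simps)
      also have "\<dots> = of_real (x - y) * (P z * (s x * s y) - of_real p2)"
        unfolding s_diff by (simp add: algebra_simps)
      also have "Re (\<kappa> * \<dots>) = d x y * (x - y)"
      proof -
        have "\<kappa> * (of_real (x - y) * (P z * (s x * s y) - of_real p2))
           = of_real (x - y) * (\<kappa> * (P z * (s x * s y) - of_real p2))" by (simp add: algebra_simps)
        thus ?thesis by (simp only: d_def Re_of_real_mult mult.commute)
      qed
      finally show ?thesis .
    qed
    have isCont_d: "isCont (\<lambda>x. d x y) y'" "isCont (\<lambda>x. d x x) y'" for y y'
      unfolding d_def by - (intro isCont_Re continuous_intros isCont_s)+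
    obtain K \<delta> where \<delta>: "\<delta> > 0" and K: "\<And>\<epsilon> x. \<bar>\<epsilon>\<bar> < \<delta> \<Longrightarrow>
        w x * exp (\<epsilon> * (q x * g x) - K * \<epsilon>\<^sup>2) \<le> w (x + \<epsilon> * (p x * g x))"
      using perturb[of \<kappa>] unfolding g_def s_def by auto
    \<comment> \<open>second-order errors of the pairs, of the Jacobian and of the weight\<close>
    define K' where "K' = 4 * c * B\<^sup>2 + 2 * B\<^sup>2 + K"
    show ?thesis
    proof (rule linear_le_quadratic_imp_zero[where K = K'])
      show "min \<delta> (1 / (2 * (B + 1))) > 0" using \<delta> B0 by simp
      fix \<epsilon> :: real assume \<epsilon>: "\<bar>\<epsilon>\<bar> < min \<delta> (1 / (2 * (B + 1)))"
      have \<epsilon>d: "\<bar>\<epsilon> * d x y\<bar> \<le> 1 / 2" for x y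
      proof -
        have "\<bar>\<epsilon> * d x y\<bar> \<le> 1 / (2 * (B + 1)) * B"
          unfolding abs_mult using \<epsilon> dB[of x y] B0 by (intro mult_mono) auto
        also have "\<dots> \<le> 1 / 2" using B0 by (simp add: field_simps)
        finally show ?thesis .
      qed
      have pos: "1 + \<epsilon> * d x y > 0" for x y using \<epsilon>d[of x y] by linarith
      have ln_ge: "\<epsilon> * d x y - 2 * \<epsilon>\<^sup>2 * B\<^sup>2 \<le> ln (1 + \<epsilon> * d x y)" for x y
      proof -
        have "(d x y)\<^sup>2 \<le> B\<^sup>2" using dB[of x y] by (metis abs_ge_zero power2_abs power_mono)
        hence "2 * (\<epsilon> * d x y)\<^sup>2 \<le> 2 * \<epsilon>\<^sup>2 * B\<^sup>2" by (simp add: power_mult_distrib mult_left_mono)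
        thus ?thesis using abs_ln_one_plus_x_minus_x_bound[OF \<epsilon>d[of x y]] by linarith
      qed
      \<comment> \<open>the last term pays for the diagonal, which the sum over pairs does not contain\<close>
      define T where "T = (\<lambda>N x. \<epsilon> * Re (\<kappa> * Z (\<sigma>1 N x) (\<sigma>2 N x)) - K' * \<epsilon>\<^sup>2 - \<bar>\<epsilon>\<bar> * c * B / real N)"
      have "\<epsilon> * Re (\<kappa> * Z S1 S2) - K' * \<epsilon>\<^sup>2 - 0 \<le> 0"
      proof (rule high_temperature_rate_nonpos[OF htl _ w, where \<phi> = "\<lambda>x. x + \<epsilon> * (p x * g x)"
            and \<phi>' = "\<lambda>x. 1 + \<epsilon> * d x x" and e = "\<lambda>x y. ln (1 + \<epsilon> * d x y)"
            and \<psi> = "\<lambda>x. \<epsilon> * (q x * g x) - K * \<epsilon>\<^sup>2" and \<xi> = "\<lambda>x. ln (1 + \<epsilon> * d x x)" and T = T])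
        show "c \<ge> 0" using c_pos by simp
        have "((\<lambda>x. p x * g x) has_real_derivative d x x) (at x)" for x
          unfolding CARAT_DERIV by (intro exI[of _ "\<lambda>y. d y x"] conjI allI pg_diff isCont_d(1) refl)
        thus "((\<lambda>x. x + \<epsilon> * (p x * g x)) has_real_derivative 1 + \<epsilon> * d x x) (at x)" for x
          by (intro DERIV_add DERIV_ident DERIV_cmult)
        show "continuous_on UNIV (\<lambda>x. 1 + \<epsilon> * d x x)"
          using isCont_d by (intro continuous_at_imp_continuous_on ballI continuous_intros)
        show "exp (ln (1 + \<epsilon> * d x y)) * \<bar>x - y\<bar>
            \<le> \<bar>x + \<epsilon> * (p x * g x) - (y + \<epsilon> * (p y * g y))\<bar>" for x y
        proof -
          have "x + \<epsilon> * (p x * g x) - (y + \<epsilon> * (p y * g y)) = (x - y) + \<epsilon> * (p x * g x - p y * g y)"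
            by (simp add: algebra_simps)
          also have "\<dots> = (1 + \<epsilon> * d x y) * (x - y)" unfolding pg_diff by (simp add: algebra_simps)
          finally show ?thesis using pos[of x y] by (simp add: abs_mult)
        qed
        show "w x * exp (\<epsilon> * (q x * g x) - K * \<epsilon>\<^sup>2) \<le> w (x + \<epsilon> * (p x * g x))" for x
          using K[of \<epsilon> x] \<epsilon> by simp
        show "exp (ln (1 + \<epsilon> * d x x)) \<le> 1 + \<epsilon> * d x x" for x using pos[of x x] by simp
        have [measurable]: "s \<in> borel_measurable borel"
          using isCont_s by (intro borel_measurable_continuous_onI continuous_at_imp_continuous_on) auto
        show "T N \<in> borel_measurable (\<Pi>\<^sub>M i\<in>{..<N}. lborel)" for N
          unfolding T_def Z_def \<sigma>1_def \<sigma>2_def by measurable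
        show "real N * T N x \<le> 2 * c / real N * (\<Sum>j<N. \<Sum>i<j. ln (1 + \<epsilon> * d (x j) (x i)))
            + (\<Sum>l<N. \<epsilon> * (q (x l) * g (x l)) - K * \<epsilon>\<^sup>2 + ln (1 + \<epsilon> * d (x l) (x l)))"
          if N: "N \<ge> 1" for N x
        proof -
          have N0: "real N > 0" using N by simp
          define D where "D = (\<Sum>j<N. \<Sum>i<j. d (x j) (x i))"
          define D0 where "D0 = (\<Sum>j<N. d (x j) (x j))"
          have \<Sigma>1: "(\<Sum>i<N. s (x i)) = of_nat N * \<sigma>1 N x"
            and \<Sigma>2: "(\<Sum>i<N. s (x i) * s (x i)) = of_nat N * \<sigma>2 N x"
            using N0 by (auto simp: \<sigma>1_def \<sigma>2_def scaleR_conv_of_real power2_eq_square)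
          have "(\<Sum>j<N. \<Sum>i<N. d (x j) (x i)) = Re (\<Sum>j<N. \<Sum>i<N. \<kappa> * (P z * (s (x j) * s (x i)) - of_real p2))"
            unfolding d_def by simp
          also have "(\<Sum>j<N. \<Sum>i<N. \<kappa> * (P z * (s (x j) * s (x i)) - of_real p2))
              = \<kappa> * (P z * ((\<Sum>j<N. s (x j)) * (\<Sum>i<N. s (x i))) - of_nat N * of_nat N * of_real p2)"
            by (simp add: sum_product sum_distrib_left[symmetric] sum_subtractf)
          also have "\<dots> = of_real (real N * real N) * (\<kappa> * (P z * (\<sigma>1 N x)\<^sup>2 - of_real p2))"
            unfolding \<Sigma>1 by (simp add: algebra_simps power2_eq_square)
          finally have D2: "(\<Sum>j<N. \<Sum>i<N. d (x j) (x i))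
              = real N * real N * Re (\<kappa> * (P z * (\<sigma>1 N x)\<^sup>2 - of_real p2))"
            by (simp only: Re_of_real_mult)
          have D: "D = (real N * real N * Re (\<kappa> * (P z * (\<sigma>1 N x)\<^sup>2 - of_real p2)) - D0) / 2"
            unfolding D_def D0_def D2[symmetric] by (rule sum_ordered_pairs) (rule d_sym)
          have "D0 = Re (\<Sum>j<N. \<kappa> * (P z * (s (x j) * s (x j)) - of_real p2))"
            unfolding D0_def d_def by simp
          also have "(\<Sum>j<N. \<kappa> * (P z * (s (x j) * s (x j)) - of_real p2))
              = \<kappa> * (P z * (\<Sum>j<N. s (x j) * s (x j)) - of_nat N * of_real p2)"
            by (simp add: sum_distrib_left[symmetric] sum_subtractf)
          also have "\<dots> = of_real (real N) * (\<kappa> * (P z * \<sigma>2 N x - of_real p2))"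
            unfolding \<Sigma>2 by (simp add: algebra_simps)
          finally have D0: "D0 = real N * Re (\<kappa> * (P z * \<sigma>2 N x - of_real p2))"
            by (simp only: Re_of_real_mult)
          have "\<kappa> * s t * of_real (q t) = \<kappa> * (Q z * s t - of_real q1)" for t
            using qs[of t] by (simp add: mult_ac)
          hence "q t * g t = Re (\<kappa> * (Q z * s t - of_real q1))" for t
            unfolding g_def by (metis Re_of_real_mult mult.commute)
          hence "(\<Sum>l<N. q (x l) * g (x l)) = Re (\<Sum>l<N. \<kappa> * (Q z * s (x l) - of_real q1))" by simp
          also have "(\<Sum>l<N. \<kappa> * (Q z * s (x l) - of_real q1)) = \<kappa> * (Q z * (\<Sum>l<N. s (x l)) - of_nat N * of_real q1)"
            by (simp add: sum_distrib_left[symmetric] sum_subtractf)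
          also have "\<dots> = of_real (real N) * (\<kappa> * (Q z * \<sigma>1 N x - of_real q1))"
            unfolding \<Sigma>1 by (simp add: algebra_simps)
          finally have Qg: "(\<Sum>l<N. q (x l) * g (x l)) = real N * Re (\<kappa> * (Q z * \<sigma>1 N x - of_real q1))"
            by (simp only: Re_of_real_mult)
          have "\<bar>D0\<bar> \<le> (\<Sum>j<N. B)"
            unfolding D0_def by (intro order.trans[OF sum_abs] sum_mono dB)
          hence D0B: "\<bar>D0\<bar> \<le> real N * B" by simp
          have "\<epsilon> * D - 2 * \<epsilon>\<^sup>2 * B\<^sup>2 * (real N * real N) \<le> \<epsilon> * D - 2 * \<epsilon>\<^sup>2 * B\<^sup>2 * (\<Sum>j<N. real j)"
          proof -
            have "(\<Sum>j<N. real j) \<le> (\<Sum>j<N. real N)" by (intro sum_mono) auto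
            thus ?thesis by (simp add: mult_left_mono)
          qed
          also have "\<dots> = (\<Sum>j<N. \<Sum>i<j. \<epsilon> * d (x j) (x i) - 2 * \<epsilon>\<^sup>2 * B\<^sup>2)"
            by (simp add: D_def sum_subtractf sum_distrib_left sum_distrib_right mult_ac)
          also have "\<dots> \<le> (\<Sum>j<N. \<Sum>i<j. ln (1 + \<epsilon> * d (x j) (x i)))"
            by (intro sum_mono ln_ge)
          finally have "2 * c / real N * (\<epsilon> * D - 2 * \<epsilon>\<^sup>2 * B\<^sup>2 * (real N * real N))
              \<le> 2 * c / real N * (\<Sum>j<N. \<Sum>i<j. ln (1 + \<epsilon> * d (x j) (x i)))"
            using c_pos by (intro mult_left_mono) auto
          moreover have "2 * c / real N * (\<epsilon> * D - 2 * \<epsilon>\<^sup>2 * B\<^sup>2 * (real N * real N))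
              = c * \<epsilon> * real N * Re (\<kappa> * (P z * (\<sigma>1 N x)\<^sup>2 - of_real p2)) - c * (\<epsilon> * D0 / real N)
                - 4 * c * B\<^sup>2 * \<epsilon>\<^sup>2 * real N"
            unfolding D using N0 by (simp add: field_simps)
          moreover have "c * (\<epsilon> * D0 / real N) \<le> c * (\<bar>\<epsilon>\<bar> * B)"
          proof -
            have "\<epsilon> * D0 \<le> \<bar>\<epsilon>\<bar> * \<bar>D0\<bar>" by (metis abs_ge_self abs_mult)
            also have "\<dots> \<le> \<bar>\<epsilon>\<bar> * (real N * B)" using D0B by (intro mult_left_mono) auto
            finally have "\<epsilon> * D0 / real N \<le> \<bar>\<epsilon>\<bar> * B" using N0 by (simp add: field_simps)
            thus ?thesis using c_pos by (intro mult_left_mono) auto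
          qed
          moreover have "(\<Sum>l<N. \<epsilon> * (q (x l) * g (x l)) - K * \<epsilon>\<^sup>2 + ln (1 + \<epsilon> * d (x l) (x l)))
              \<ge> (\<Sum>l<N. \<epsilon> * (q (x l) * g (x l)) - K * \<epsilon>\<^sup>2 + (\<epsilon> * d (x l) (x l) - 2 * \<epsilon>\<^sup>2 * B\<^sup>2))"
            by (intro sum_mono add_left_mono ln_ge)
          moreover have "(\<Sum>l<N. \<epsilon> * (q (x l) * g (x l)) - K * \<epsilon>\<^sup>2 + (\<epsilon> * d (x l) (x l) - 2 * \<epsilon>\<^sup>2 * B\<^sup>2))
              = \<epsilon> * (\<Sum>l<N. q (x l) * g (x l)) - real N * K * \<epsilon>\<^sup>2 + \<epsilon> * D0 - real N * (2 * \<epsilon>\<^sup>2 * B\<^sup>2)"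
            by (simp add: D0_def sum_subtractf sum.distrib sum_distrib_left)
          moreover have "real N * T N x = c * \<epsilon> * real N * Re (\<kappa> * (P z * (\<sigma>1 N x)\<^sup>2 - of_real p2))
              + \<epsilon> * (\<Sum>l<N. q (x l) * g (x l)) + \<epsilon> * D0 - real N * K * \<epsilon>\<^sup>2 - real N * (2 * \<epsilon>\<^sup>2 * B\<^sup>2)
              - 4 * c * B\<^sup>2 * \<epsilon>\<^sup>2 * real N - c * (\<bar>\<epsilon>\<bar> * B)"
          proof -
            have "Re (\<kappa> * Z (\<sigma>1 N x) (\<sigma>2 N x)) = c * Re (\<kappa> * (P z * (\<sigma>1 N x)\<^sup>2 - of_real p2))
                + Re (\<kappa> * (P z * \<sigma>2 N x - of_real p2)) + Re (\<kappa> * (Q z * \<sigma>1 N x - of_real q1))"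
            proof -
              have "\<kappa> * Z (\<sigma>1 N x) (\<sigma>2 N x) = of_real c * (\<kappa> * (P z * (\<sigma>1 N x)\<^sup>2 - of_real p2))
                + \<kappa> * (P z * \<sigma>2 N x - of_real p2) + \<kappa> * (Q z * \<sigma>1 N x - of_real q1)"
                unfolding Z_def k0_def by (simp add: algebra_simps)
              thus ?thesis
                by (simp only: Re_of_real_mult plus_complex.simps)
            qed
            moreover have "real N * (\<epsilon> * (c * r1 + r2 + r3) - K' * \<epsilon>\<^sup>2 - \<bar>\<epsilon>\<bar> * c * B / real N)
              = c * \<epsilon> * real N * r1 + \<epsilon> * (real N * r3) + \<epsilon> * (real N * r2) - real N * K * \<epsilon>\<^sup>2
                - real N * (2 * \<epsilon>\<^sup>2 * B\<^sup>2) - 4 * c * B\<^sup>2 * \<epsilon>\<^sup>2 * real N - c * (\<bar>\<epsilon>\<bar> * B)"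
              for r1 r2 r3 :: real
              unfolding K'_def using N0 by (simp add: field_simps)
            ultimately show ?thesis unfolding T_def Qg D0 by (simp only:)
          qed
          ultimately show ?thesis by linarith
        qed
        show "AE \<omega> in \<Omega>. (\<lambda>N. T (Suc N) (\<lambda>i\<in>{..<Suc N}. X (Suc N) i \<omega>))
            \<longlonglongrightarrow> \<epsilon> * Re (\<kappa> * Z S1 S2) - K' * \<epsilon>\<^sup>2 - 0"
          using lim1 lim2
        proof eventually_elim
          case (elim \<omega>)
          have restr: "\<sigma>1 (Suc N) (\<lambda>i\<in>{..<Suc N}. X (Suc N) i \<omega>) = \<sigma>1 (Suc N) (\<lambda>i. X (Suc N) i \<omega>)"
            "\<sigma>2 (Suc N) (\<lambda>i\<in>{..<Suc N}. X (Suc N) i \<omega>) = \<sigma>2 (Suc N) (\<lambda>i. X (Suc N) i \<omega>)" for N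
            unfolding \<sigma>1_def \<sigma>2_def by (auto intro!: arg_cong2[where f = scaleR] sum.cong)
          have "(\<lambda>N. \<bar>\<epsilon>\<bar> * c * B / real (Suc N)) \<longlonglongrightarrow> 0"
            by (rule LIMSEQ_Suc) (rule lim_const_over_n)
          thus ?case unfolding T_def restr Z_def by (intro tendsto_intros elim)
        qed
      qed
      thus "\<epsilon> * Re (\<kappa> * Z S1 S2) \<le> K' * \<epsilon>\<^sup>2" by simp
    qed
  qed
  \<comment> \<open>with this \<open>\<kappa>\<close> the real part is \<open>\<bar>Z\<bar>\<^sup>2\<close>\<close>
  from this[of "cnj (Z S1 S2)"] have "Z S1 S2 = 0"
    by (simp add: complex_eq_iff)
  thus ?thesis by (simp add: Z_def S1_def S2_def)
qed

end

section \<open>First moments and the reduction to the upper half-plane\<close>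

text \<open>  Weak convergence sees only the truncations of \<open>\<bar>u\<bar>\<close>, but their averages are bounded
  independently of the truncation: by \<open>gain\<close>, moving the particles by \<open>x \<mapsto> s x\<close> gains at least
  \<open>a \<bar>x\<bar> - b\<close> from the weight and loses only a constant per particle from the other terms.\<close>

lemma high_temperature_limit_first_moment:
  assumes htl: "high_temperature_limit \<Omega> X c w \<mu>" and c: "c \<ge> 0" and w: "\<And>x. w x \<ge> 0"
    and s: "s > 0" and a: "a > 0"
    and gain: "\<And>x. w x * exp (a * \<bar>x\<bar> - b) \<le> w (s * x)"
  shows "integrable \<mu> (\<lambda>u. u)"
proof -
  interpret real_distribution \<mu> using htl by (simp add: high_temperature_limit_def)
  define K where "K = b + 2 * c * \<bar>ln s\<bar> + \<bar>ln s\<bar>"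
  have trunc: "(\<integral>u. min \<bar>u\<bar> (real M) \<partial>\<mu>) \<le> K / a" for M
  proof -
    define T where "T = (\<lambda>N x. a * ((\<Sum>i<N. min \<bar>x i :: real\<bar> (real M)) /\<^sub>R real N) - K)"
    have "a * (\<integral>u. min \<bar>u\<bar> (real M) \<partial>\<mu>) - K \<le> 0"
    proof (rule high_temperature_rate_nonpos[OF htl c w, where \<phi> = "\<lambda>x. s * x" and \<phi>' = "\<lambda>_. s"
          and e = "\<lambda>_ _. ln s" and \<psi> = "\<lambda>x. a * \<bar>x\<bar> - b" and \<xi> = "\<lambda>_. ln s" and T = T])
      show "((\<lambda>x. s * x) has_real_derivative s) (at x)" for x
        by (auto intro!: derivative_eq_intros)
      show "exp (ln s) * \<bar>x - y\<bar> \<le> \<bar>s * x - s * y\<bar>" for x y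
        using s by (simp add: abs_mult flip: right_diff_distrib)
      show "T N \<in> borel_measurable (\<Pi>\<^sub>M i\<in>{..<N}. lborel)" for N
        unfolding T_def by measurable
      show "real N * T N x \<le> 2 * c / real N * (\<Sum>j<N. \<Sum>i<j. ln s) + (\<Sum>l<N. a * \<bar>x l\<bar> - b + ln s)"
        if N: "N \<ge> 1" for N x
      proof -
        have "(\<Sum>j<N. real j) \<le> (\<Sum>j<N. real N)" by (intro sum_mono) auto
        hence "2 * c / real N * \<bar>ln s\<bar> * (\<Sum>j<N. real j) \<le> 2 * c / real N * \<bar>ln s\<bar> * (real N * real N)"
          using c by (intro mult_left_mono) auto
        moreover have "2 * c / real N * (\<Sum>j<N. \<Sum>i<j. ln s) = 2 * c / real N * ln s * (\<Sum>j<N. real j)"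
          by (simp add: sum_distrib_left sum_divide_distrib mult_ac)
        moreover have "- (2 * c / real N * \<bar>ln s\<bar> * (\<Sum>j<N. real j)) \<le> 2 * c / real N * ln s * (\<Sum>j<N. real j)"
        proof -
          have "2 * c / real N * (\<Sum>j<N. real j) * (- \<bar>ln s\<bar>) \<le> 2 * c / real N * (\<Sum>j<N. real j) * ln s"
            using c by (intro mult_left_mono mult_nonneg_nonneg sum_nonneg) auto
          thus ?thesis by (simp add: mult_ac)
        qed
        moreover have "2 * c / real N * \<bar>ln s\<bar> * (real N * real N) = 2 * c * \<bar>ln s\<bar> * real N"
          using N by simp
        moreover have "a * (\<Sum>i<N. min \<bar>x i\<bar> (real M)) \<le> a * (\<Sum>i<N. \<bar>x i\<bar>)"
          using a by (intro mult_left_mono sum_mono) auto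
        moreover have "(\<Sum>l<N. a * \<bar>x l\<bar> - b + ln s) = a * (\<Sum>i<N. \<bar>x i\<bar>) - real N * b + real N * ln s"
          by (simp add: sum.distrib sum_subtractf sum_distrib_left)
        moreover have "- (real N * \<bar>ln s\<bar>) \<le> real N * ln s"
          using mult_left_mono[of "- \<bar>ln s\<bar>" "ln s" "real N"] by simp
        moreover have "real N * T N x = a * (\<Sum>i<N. min \<bar>x i\<bar> (real M)) - real N * b
            - 2 * c * \<bar>ln s\<bar> * real N - real N * \<bar>ln s\<bar>"
          unfolding T_def K_def using N by (simp add: algebra_simps)
        ultimately show ?thesis by linarith
      qed
      have "AE \<omega> in \<Omega>. (\<lambda>N. (\<Sum>i<Suc N. min \<bar>X (Suc N) i \<omega>\<bar> (real M)) /\<^sub>R real (Suc N))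
          \<longlonglongrightarrow> (\<integral>u. min \<bar>u\<bar> (real M) \<partial>\<mu>)"
        by (rule high_temperature_limit_integral[OF htl, where B = "real M"])
          (auto intro!: continuous_intros)
      thus "AE \<omega> in \<Omega>. (\<lambda>N. T (Suc N) (\<lambda>i\<in>{..<Suc N}. X (Suc N) i \<omega>))
          \<longlonglongrightarrow> a * (\<integral>u. min \<bar>u\<bar> (real M) \<partial>\<mu>) - K"
      proof eventually_elim
        case (elim \<omega>)
        have "(\<Sum>i<Suc N. min \<bar>(\<lambda>i\<in>{..<Suc N}. X (Suc N) i \<omega>) i\<bar> (real M))
            = (\<Sum>i<Suc N. min \<bar>X (Suc N) i \<omega>\<bar> (real M))" for N
          by (intro sum.cong) auto
        thus ?case unfolding T_def using elim by (auto intro!: tendsto_intros simp del: sum.lessThan_Suc)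
      qed
    qed (use s gain in auto)
    thus ?thesis using a by (simp add: field_simps)
  qed
  have "(\<integral>\<^sup>+u. ennreal \<bar>u\<bar> \<partial>\<mu>) = (\<integral>\<^sup>+u. (SUP M. ennreal (min \<bar>u\<bar> (real M))) \<partial>\<mu>)"
  proof (intro nn_integral_cong antisym)
    fix u :: real
    obtain M where "\<bar>u\<bar> \<le> real M" using real_arch_simple by blast
    thus "ennreal \<bar>u\<bar> \<le> (SUP M. ennreal (min \<bar>u\<bar> (real M)))"
      by (intro SUP_upper2[of M]) auto
  qed (auto intro!: SUP_least ennreal_leI)
  also have "\<dots> = (SUP M. \<integral>\<^sup>+u. ennreal (min \<bar>u\<bar> (real M)) \<partial>\<mu>)"
    by (rule nn_integral_monotone_convergence_SUP) (auto intro!: incseq_SucI le_funI ennreal_leI)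
  also have "\<dots> \<le> ennreal (K / a)"
  proof (rule SUP_least)
    fix M
    have "integrable \<mu> (\<lambda>u. min \<bar>u\<bar> (real M))"
      by (rule integrable_const_bound[of _ "real M"]) auto
    hence "(\<integral>\<^sup>+u. ennreal (min \<bar>u\<bar> (real M)) \<partial>\<mu>) = ennreal (\<integral>u. min \<bar>u\<bar> (real M) \<partial>\<mu>)"
      by (rule nn_integral_eq_integral) auto
    thus "(\<integral>\<^sup>+u. ennreal (min \<bar>u\<bar> (real M)) \<partial>\<mu>) \<le> ennreal (K / a)"
      using trunc[of M] by (simp add: ennreal_leI)
  qed
  finally show ?thesis
    by (intro integrableI_bounded) (auto simp: le_less_trans)
qed

text \<open>  The lower half-plane follows by conjugation, which commutes with the principal branches off the
  negative real axis.\<close>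

lemma markov_krein_from_upper_half_plane:
  assumes \<nu>: "real_distribution \<nu>" and \<mu>: "real_distribution \<mu>" and m\<mu>: "integrable \<mu> (\<lambda>u. u)"
    and eq: "\<And>z. Im z > 0 \<Longrightarrow> stieltjes c \<nu> z = exp (- of_real c * log_potential \<mu> z)"
  shows "markov_krein c \<nu> \<mu>"
  unfolding markov_krein_def
proof (intro conjI allI impI)
  interpret \<mu>: real_distribution \<mu> by fact
  show "integrable \<mu> (\<lambda>u. ln (1 + \<bar>u\<bar>))"
  proof (rule Bochner_Integration.integrable_bound[OF m\<mu>])
    have "norm (ln (1 + \<bar>u\<bar>)) \<le> norm u" for u :: real
      using ln_add_one_self_le_self[of "\<bar>u\<bar>"] by simp
    thus "AE u in \<mu>. norm (ln (1 + \<bar>u\<bar>)) \<le> norm u" by simp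
  qed auto
  have up: "(\<integral>t. 1 / (z - complex_of_real t) powr complex_of_real c \<partial>\<nu>) =
      exp (- complex_of_real c * (\<integral>u. Ln (z - complex_of_real u) \<partial>\<mu>))" if "Im z > 0" for z
    using eq[OF that] unfolding stieltjes_def log_potential_def by (simp add: powr_minus_divide)
  fix z :: complex assume "z \<notin> \<real>"
  hence "Im z \<noteq> 0" by (simp add: complex_is_Real_iff)
  then consider "Im z > 0" | "Im z < 0" by linarith
  thus "(\<integral>t. 1 / (z - complex_of_real t) powr complex_of_real c \<partial>\<nu>) =
      exp (- complex_of_real c * (\<integral>u. Ln (z - complex_of_real u) \<partial>\<mu>))"
  proof cases
    case 2
    have Ln: "Ln (z - complex_of_real t) = cnj (Ln (cnj z - complex_of_real t))" for t
    proof -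
      have "cnj z - complex_of_real t \<notin> \<real>\<^sub>\<le>\<^sub>0" using 2 by (auto simp: complex_nonpos_Reals_iff)
      from cnj_Ln[OF this] show ?thesis by simp
    qed
    have pw: "1 / (z - complex_of_real t) powr complex_of_real c
        = cnj (1 / (cnj z - complex_of_real t) powr complex_of_real c)" for t
    proof -
      have "z - complex_of_real t \<noteq> 0" "cnj z - complex_of_real t \<noteq> 0"
        using 2 by (auto simp: complex_eq_iff)
      thus ?thesis by (simp add: powr_def Ln exp_cnj)
    qed
    show ?thesis
    proof -
      have "Im (cnj z) > 0" using 2 by simp
      from up[OF this] show ?thesis
        unfolding pw Ln Bochner_Integration.integral_cnj by (simp only: exp_cnj complex_cnj_mult complex_cnj_minus complex_cnj_complex_of_real)
    qed
  qed (rule up)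
qed (use \<nu> \<mu> in auto)

section \<open>The Markov--Krein relation for Pearson weights\<close>

theorem (in pearson) high_temperature_markov_krein:
  fixes l u :: ereal
  assumes htl: "high_temperature_limit \<Omega> X c w \<mu>" and w: "\<And>x. w x \<ge> 0"
    and m\<mu>: "integrable \<mu> (\<lambda>u. u)"
    and perturb: "\<And>z \<kappa>. Im z > 0 \<Longrightarrow> \<exists>K \<delta>. \<delta> > 0 \<and> (\<forall>\<epsilon> x. \<bar>\<epsilon>\<bar> < \<delta> \<longrightarrow>
      w x * exp (\<epsilon> * (q x * Re (\<kappa> / (z - of_real x))) - K * \<epsilon>\<^sup>2)
        \<le> w (x + \<epsilon> * (p x * Re (\<kappa> / (z - of_real x)))))"
    and \<nu>: "real_distribution \<nu>" and m\<nu>: "integrable \<nu> (\<lambda>t. t)"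
    and dens: "\<nu> = density lborel (\<lambda>t. ennreal (\<rho> t))"
    and \<rho>: "\<rho> \<in> borel_measurable borel" "\<And>t. \<rho> t \<ge> 0"
    and lu: "l < u" and supp: "\<And>t. \<not> (l < ereal t \<and> ereal t < u) \<Longrightarrow> \<rho> t = 0"
    and deriv: "\<And>t. l < ereal t \<Longrightarrow> ereal t < u \<Longrightarrow>
      ((\<lambda>t. p t * \<rho> t) has_real_derivative ((c + 1) * p' t + q t) * \<rho> t) (at t)"
    and cont: "\<And>t. l < ereal t \<Longrightarrow> ereal t < u \<Longrightarrow> isCont \<rho> t"
    and lims: "(((\<lambda>t. p t * \<rho> t) \<circ> real_of_ereal) \<longlongrightarrow> 0) (at_right l)"
      "(((\<lambda>t. p t * \<rho> t) \<circ> real_of_ereal) \<longlongrightarrow> 0) (at_left u)"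
    and P: "\<And>z. Im z > 0 \<Longrightarrow> P z \<noteq> 0"
    and V: "\<And>z. Im z > 0 \<Longrightarrow> (V has_field_derivative Q z / P z) (at z)"
    and growth: "\<And>y. y \<ge> 1 \<Longrightarrow> Re (V (\<i> * of_real y)) \<ge> - 2 * ln y - K"
  shows "markov_krein c \<nu> \<mu>"
proof (rule markov_krein_from_upper_half_plane[OF \<nu> _ m\<mu>])
  show \<mu>: "real_distribution \<mu>" using htl by (simp add: high_temperature_limit_def)
  fix z assume "Im z > 0"
  show "stieltjes c \<nu> z = exp (- of_real c * log_potential \<mu> z)"
  proof (rule markov_krein_upper_half_plane[OF \<mu> m\<mu> \<nu> m\<nu> _ _ P V growth \<open>Im z > 0\<close>])
    fix z assume z: "Im z > 0"
    show "P z * (of_real c * (stieltjes 1 \<mu> z)\<^sup>2 + stieltjes 2 \<mu> z) + Q z * stieltjes 1 \<mu> z = of_real k0"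
      by (rule loop_equation[OF htl w perturb[OF z] z])
    show "of_real (c + 1) * P z * stieltjes (c + 2) \<nu> z + Q z * stieltjes (c + 1) \<nu> z
        = of_real k0 * stieltjes c \<nu> z"
      by (rule stieltjes_ode[OF \<nu> z integral_pearson_integrand_eq_0[OF \<nu> dens \<rho> lu supp deriv cont lims z]])
  qed
qed

lemma abs_Re_divide_shift_le:
  assumes "Im z > 0"
  shows "\<bar>Re (\<kappa> / (z - of_real x))\<bar> \<le> norm \<kappa> / Im z"
proof -
  have "Im z \<le> norm (z - complex_of_real x)"
    using abs_Im_le_cmod[of "z - complex_of_real x"] assms by simp
  hence "norm (\<kappa> / (z - of_real x)) \<le> norm \<kappa> / Im z"
    using assms by (simp add: norm_divide frac_le)
  thus ?thesis using abs_Re_le_cmod order.trans by blast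
qed

lemma powr_one_plus_ge:
  fixes a v :: real
  assumes "\<bar>v\<bar> \<le> 1 / 2"
  shows "exp (a * v - 2 * \<bar>a\<bar> * v\<^sup>2) \<le> (1 + v) powr a"
proof -
  have "\<bar>a * (ln (1 + v) - v)\<bar> \<le> \<bar>a\<bar> * (2 * v\<^sup>2)"
    unfolding abs_mult using abs_ln_one_plus_x_minus_x_bound[OF assms] by (intro mult_left_mono) auto
  hence "a * v - 2 * \<bar>a\<bar> * v\<^sup>2 \<le> a * ln (1 + v)" by (simp add: algebra_simps)
  thus ?thesis using assms by (simp add: powr_def)
qed

lemma scaled_square_le:
  fixes g :: real
  assumes "\<bar>g\<bar> \<le> M" and "k \<ge> 0"
  shows "2 * k * (\<epsilon> * g)\<^sup>2 \<le> 2 * k * M\<^sup>2 * \<epsilon>\<^sup>2"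
proof -
  have "g\<^sup>2 \<le> M\<^sup>2" using assms(1) by (metis abs_ge_zero power2_abs power_mono)
  hence "2 * k * \<epsilon>\<^sup>2 * g\<^sup>2 \<le> 2 * k * \<epsilon>\<^sup>2 * M\<^sup>2" using assms(2) by (intro mult_left_mono) auto
  thus ?thesis by (simp add: power_mult_distrib mult_ac)
qed

section \<open>The Gaussian ensemble\<close>

text \<open>  \<open>p = 1\<close>, \<open>q = - x\<close>; the continuation \<open>exp (- z\<^sup>2 / 2)\<close> of the weight grows on the imaginary axis.\<close>

lemma gaussian_markov_krein:
  assumes c: "c > 0" and htl: "high_temperature_limit \<Omega> X c gaussian_weight \<mu>"
  shows "markov_krein c std_normal_distribution \<mu>"
proof -
  interpret pearson 1 0 0 0 "-1" c by unfold_locales (rule c)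
  note defs = p_def p'_def q_def P_def Q_def
  have w: "gaussian_weight x \<ge> 0" for x by (simp add: gaussian_weight_def)
  show ?thesis
  proof (rule high_temperature_markov_krein[OF htl w, where l = "-\<infinity>" and u = "\<infinity>"
        and \<rho> = std_normal_density and V = "\<lambda>z. - z\<^sup>2 / 2" and K = 0])
    \<comment> \<open>scaling by \<open>1 / 2\<close> gains \<open>3 x\<^sup>2 / 8\<close>, and \<open>\<bar>x\<bar> \<le> x\<^sup>2 + 1\<close>\<close>
    have gain: "gaussian_weight x * exp (3 / 8 * \<bar>x\<bar> - 3 / 8) \<le> gaussian_weight (1 / 2 * x)" for x
    proof -
      have "\<bar>x\<bar> \<le> x\<^sup>2 + 1" using sum_power2_ge_zero[of "\<bar>x\<bar> - 1 / 2" 0]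
        by (simp add: power2_eq_square algebra_simps)
      thus ?thesis by (simp add: gaussian_weight_def exp_add[symmetric] power_divide)
    qed
    show "integrable \<mu> (\<lambda>u. u)"
      by (rule high_temperature_limit_first_moment[OF htl _ w _ _ gain]) (use c in auto)
    show "\<exists>K \<delta>. \<delta> > 0 \<and> (\<forall>\<epsilon> x. \<bar>\<epsilon>\<bar> < \<delta> \<longrightarrow>
        gaussian_weight x * exp (\<epsilon> * (q x * Re (\<kappa> / (z - of_real x))) - K * \<epsilon>\<^sup>2)
        \<le> gaussian_weight (x + \<epsilon> * (p x * Re (\<kappa> / (z - of_real x)))))" if z: "Im z > 0" for z \<kappa>
    proof (rule exI[of _ "(norm \<kappa> / Im z)\<^sup>2 / 2"], rule exI[of _ "1::real"], intro conjI allI impI)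
      fix \<epsilon> x :: real
      define g where "g = Re (\<kappa> / (z - of_real x))"
      have "g\<^sup>2 \<le> (norm \<kappa> / Im z)\<^sup>2"
        using abs_Re_divide_shift_le[OF z, of \<kappa> x] unfolding g_def
        by (metis abs_ge_zero power2_abs power_mono)
      hence "\<epsilon>\<^sup>2 * g\<^sup>2 \<le> (norm \<kappa> / Im z)\<^sup>2 * \<epsilon>\<^sup>2"
        by (subst mult.commute) (rule mult_right_mono, auto)
      moreover have "- (x + \<epsilon> * g)\<^sup>2 / 2 = - x\<^sup>2 / 2 + \<epsilon> * (- x * g) - \<epsilon>\<^sup>2 * g\<^sup>2 / 2"
        by (simp add: power2_eq_square field_simps)
      ultimately have "- x\<^sup>2 / 2 + (\<epsilon> * (- x * g) - (norm \<kappa> / Im z)\<^sup>2 / 2 * \<epsilon>\<^sup>2) \<le> - (x + \<epsilon> * g)\<^sup>2 / 2"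
        by linarith
      thus "gaussian_weight x * exp (\<epsilon> * (q x * Re (\<kappa> / (z - of_real x))) - (norm \<kappa> / Im z)\<^sup>2 / 2 * \<epsilon>\<^sup>2)
        \<le> gaussian_weight (x + \<epsilon> * (p x * Re (\<kappa> / (z - of_real x))))"
        unfolding g_def[symmetric] defs by (simp add: gaussian_weight_def exp_add[symmetric])
    qed simp
    show "real_distribution std_normal_distribution" by (rule real_dist_normal_dist)
    show "integrable std_normal_distribution (\<lambda>t. t)"
      using integrable_std_normal_distribution_moment[of 1] by simp
    show "((\<lambda>t. p t * std_normal_density t) has_real_derivative
        ((c + 1) * p' t + q t) * std_normal_density t) (at t)" for t
    proof -
      define C where "C = 1 / sqrt (2 * pi)"
      have "std_normal_density = (\<lambda>x. C * exp (- x\<^sup>2 / 2))"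
        by (simp add: fun_eq_iff std_normal_density_def C_def)
      thus ?thesis unfolding defs by (auto intro!: derivative_eq_intros)
    qed
    show "isCont std_normal_density t" for t
      unfolding std_normal_density_def by (intro continuous_intros) auto
    show "(((\<lambda>t. p t * std_normal_density t) \<circ> real_of_ereal) \<longlongrightarrow> 0) (at_right (- \<infinity>))"
      unfolding ereal_tendsto_simps defs std_normal_density_def by simp real_asymp
    show "(((\<lambda>t. p t * std_normal_density t) \<circ> real_of_ereal) \<longlongrightarrow> 0) (at_left \<infinity>)"
      unfolding ereal_tendsto_simps defs std_normal_density_def by simp real_asymp
    show "P z \<noteq> 0" for z by (simp add: defs)
    show "((\<lambda>z. - z\<^sup>2 / 2) has_field_derivative Q z / P z) (at z)" for z
      unfolding defs by (auto intro!: derivative_eq_intros)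
    show "- 2 * ln y - 0 \<le> Re (- (\<i> * of_real y)\<^sup>2 / 2)" if "y \<ge> 1" for y
    proof -
      have "ln y \<ge> 0" using that by simp
      moreover have "y\<^sup>2 / 2 \<ge> 0" by simp
      moreover have "Re (- (\<i> * of_real y)\<^sup>2 / 2) = y\<^sup>2 / 2" by (simp add: power_mult_distrib)
      ultimately show ?thesis by linarith
    qed
  qed auto
qed

section \<open>The Laguerre ensemble\<close>

lemma integrable_Gamma_integrand:
  fixes s :: real
  assumes "s > 0"
  shows "integrable lborel (\<lambda>t. if 0 < t then t powr (s - 1) * exp (- t) else 0)" (is "integrable _ ?f")
    and "(\<integral>\<^sup>+t. ennreal (if 0 < t then t powr (s - 1) * exp (- t) else 0) \<partial>lborel) = ennreal (Gamma s)"
proof -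
  have eq: "indicator {0..} t * t powr (s - 1) / exp t = ?f t" for t
    by (auto simp: indicator_def exp_minus field_simps)
  show *: "(\<integral>\<^sup>+t. ennreal (?f t) \<partial>lborel) = ennreal (Gamma s)"
    using Gamma_conv_nn_integral_real[OF assms] unfolding eq by simp
  show "integrable lborel ?f"
    by (rule integrableI_nonneg) (auto simp: *)
qed

lemma real_distribution_density:
  assumes [measurable]: "f \<in> borel_measurable borel" and "(\<integral>\<^sup>+t. f t \<partial>lborel) = 1"
  shows "real_distribution (density lborel f)"
proof -
  have "prob_space (density lborel f)"
    by (rule prob_spaceI) (use assms in \<open>simp add: emeasure_density\<close>)
  thus ?thesis by (simp add: real_distribution_def real_distribution_axioms_def)
qed

text \<open>  \<open>p = x\<close>, \<open>q = \<alpha> - 1 - x\<close>; the continuation of the weight has modulus \<open>y powr (\<alpha> - 1)\<close> on the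
  imaginary axis.\<close>

lemma laguerre_markov_krein:
  assumes c: "c > 0" and \<alpha>: "\<alpha> > 0" and htl: "high_temperature_limit \<Omega> X c (laguerre_weight \<alpha>) \<mu>"
  shows "markov_krein c (gamma_distribution (\<alpha> + c)) \<mu>"
proof -
  interpret pearson 0 1 0 "\<alpha> - 1" "-1" c by unfold_locales (rule c)
  note defs = p_def p'_def q_def P_def Q_def
  define \<rho> where "\<rho> = (\<lambda>x. if 0 < x then x powr (\<alpha> + c - 1) * exp (- x) / Gamma (\<alpha> + c) else 0)"
  have \<Gamma>: "Gamma (\<alpha> + c) > 0" using c \<alpha> by (simp add: Gamma_real_pos)
  have w: "laguerre_weight \<alpha> x \<ge> 0" for x by (simp add: laguerre_weight_def)
  have [measurable]: "\<rho> \<in> borel_measurable borel" unfolding \<rho>_def by measurable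
  have \<rho>_nonneg: "\<rho> t \<ge> 0" for t using \<Gamma> by (simp add: \<rho>_def)
  have p\<rho>: "p t * \<rho> t = t powr (\<alpha> + c) * exp (- t) / Gamma (\<alpha> + c)" if "t > 0" for t
    using that by (simp add: defs \<rho>_def powr_mult_base[symmetric] powr_diff)
  show ?thesis
  proof (rule high_temperature_markov_krein[OF htl w, where l = 0 and u = "\<infinity>"
        and \<rho> = \<rho> and V = "\<lambda>z. of_real (\<alpha> - 1) * Ln z - z" and K = 0])
    \<comment> \<open>on \<open>(0, \<infinity>)\<close> scaling by \<open>1 / 2\<close> changes the weight exactly by this factor\<close>
    have gain: "laguerre_weight \<alpha> x * exp (1 / 2 * \<bar>x\<bar> - (\<alpha> - 1) * ln 2) \<le> laguerre_weight \<alpha> (1 / 2 * x)" for x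
    proof (cases "x > 0")
      case True
      have "(1 / 2 * x) powr (\<alpha> - 1) = x powr (\<alpha> - 1) * exp (- ((\<alpha> - 1) * ln 2))"
        using True by (simp add: powr_def ln_div exp_add[symmetric] algebra_simps)
      moreover have "exp (- x) * exp (1 / 2 * \<bar>x\<bar> - (\<alpha> - 1) * ln 2)
          = exp (- ((\<alpha> - 1) * ln 2)) * exp (- (1 / 2 * x))"
        using True by (simp add: exp_add[symmetric])
      ultimately show ?thesis using True by (simp add: laguerre_weight_def)
    qed (simp add: laguerre_weight_def)
    show "integrable \<mu> (\<lambda>u. u)"
      by (rule high_temperature_limit_first_moment[OF htl _ w _ _ gain]) (use c in auto)
    show "\<exists>K \<delta>. \<delta> > 0 \<and> (\<forall>\<epsilon> x. \<bar>\<epsilon>\<bar> < \<delta> \<longrightarrow>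
        laguerre_weight \<alpha> x * exp (\<epsilon> * (q x * Re (\<kappa> / (z - of_real x))) - K * \<epsilon>\<^sup>2)
        \<le> laguerre_weight \<alpha> (x + \<epsilon> * (p x * Re (\<kappa> / (z - of_real x)))))" if z: "Im z > 0" for z \<kappa>
    proof -
      define M where "M = norm \<kappa> / Im z"
      have M: "M \<ge> 0" using z by (simp add: M_def)
      show ?thesis
      proof (rule exI[of _ "2 * \<bar>\<alpha> - 1\<bar> * M\<^sup>2"], rule exI[of _ "1 / (2 * (M + 1))"], intro conjI allI impI)
        show "1 / (2 * (M + 1)) > 0" using M by simp
        fix \<epsilon> x :: real assume \<epsilon>: "\<bar>\<epsilon>\<bar> < 1 / (2 * (M + 1))"
        define g where "g = Re (\<kappa> / (z - of_real x))"
        have g: "\<bar>g\<bar> \<le> M" unfolding g_def M_def by (rule abs_Re_divide_shift_le[OF z])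
        have "\<bar>\<epsilon> * g\<bar> \<le> 1 / (2 * (M + 1)) * M"
          unfolding abs_mult using \<epsilon> g M by (intro mult_mono) auto
        also have "\<dots> \<le> 1 / 2" using M by (simp add: field_simps)
        finally have \<epsilon>g: "\<bar>\<epsilon> * g\<bar> \<le> 1 / 2" .
        have "2 * \<bar>\<alpha> - 1\<bar> * (\<epsilon> * g)\<^sup>2 \<le> 2 * \<bar>\<alpha> - 1\<bar> * M\<^sup>2 * \<epsilon>\<^sup>2"
          by (rule scaled_square_le[OF g]) simp
        hence "exp ((\<alpha> - 1) * (\<epsilon> * g) - 2 * \<bar>\<alpha> - 1\<bar> * M\<^sup>2 * \<epsilon>\<^sup>2) \<le> exp ((\<alpha> - 1) * (\<epsilon> * g) - 2 * \<bar>\<alpha> - 1\<bar> * (\<epsilon> * g)\<^sup>2)"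
          by simp
        also have "\<dots> \<le> (1 + \<epsilon> * g) powr (\<alpha> - 1)" by (rule powr_one_plus_ge[OF \<epsilon>g])
        finally have le: "exp ((\<alpha> - 1) * (\<epsilon> * g) - 2 * \<bar>\<alpha> - 1\<bar> * M\<^sup>2 * \<epsilon>\<^sup>2) \<le> (1 + \<epsilon> * g) powr (\<alpha> - 1)" .
        have "laguerre_weight \<alpha> x * exp (\<epsilon> * (q x * g) - 2 * \<bar>\<alpha> - 1\<bar> * M\<^sup>2 * \<epsilon>\<^sup>2)
          \<le> laguerre_weight \<alpha> (x + \<epsilon> * (p x * g))"
        proof (cases "x > 0")
          case True
          have fac: "x + \<epsilon> * (p x * g) = x * (1 + \<epsilon> * g)" by (simp add: defs algebra_simps)
          have pos: "1 + \<epsilon> * g > 0" using \<epsilon>g by linarith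
          have "\<epsilon> * (q x * g) - 2 * \<bar>\<alpha> - 1\<bar> * M\<^sup>2 * \<epsilon>\<^sup>2
              = ((\<alpha> - 1) * (\<epsilon> * g) - 2 * \<bar>\<alpha> - 1\<bar> * M\<^sup>2 * \<epsilon>\<^sup>2) + - (x * (\<epsilon> * g))"
            by (simp add: defs algebra_simps)
          hence "laguerre_weight \<alpha> x * exp (\<epsilon> * (q x * g) - 2 * \<bar>\<alpha> - 1\<bar> * M\<^sup>2 * \<epsilon>\<^sup>2)
            = x powr (\<alpha> - 1) * exp ((\<alpha> - 1) * (\<epsilon> * g) - 2 * \<bar>\<alpha> - 1\<bar> * M\<^sup>2 * \<epsilon>\<^sup>2) * (exp (- x) * exp (- (x * (\<epsilon> * g))))"
            using True by (simp only: exp_add) (simp add: laguerre_weight_def)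
          also have "\<dots> \<le> x powr (\<alpha> - 1) * (1 + \<epsilon> * g) powr (\<alpha> - 1) * (exp (- x) * exp (- (x * (\<epsilon> * g))))"
            by (intro mult_right_mono mult_left_mono le) auto
          also have "\<dots> = laguerre_weight \<alpha> (x + \<epsilon> * (p x * g))"
          proof -
            have "exp (- x) * exp (- (x * (\<epsilon> * g))) = exp (- (x * (1 + \<epsilon> * g)))"
              by (simp add: exp_add[symmetric] algebra_simps)
            moreover have "x * (1 + \<epsilon> * g) > 0" using True pos by simp
            ultimately show ?thesis
              unfolding fac using True pos by (simp only: laguerre_weight_def if_True) (simp add: powr_mult)
          qed
          finally show ?thesis .
        qed (simp add: laguerre_weight_def)
        thus "laguerre_weight \<alpha> x * exp (\<epsilon> * (q x * Re (\<kappa> / (z - of_real x))) - 2 * \<bar>\<alpha> - 1\<bar> * M\<^sup>2 * \<epsilon>\<^sup>2)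
          \<le> laguerre_weight \<alpha> (x + \<epsilon> * (p x * Re (\<kappa> / (z - of_real x))))"
          by (simp only: g_def)
      qed
    qed
    show dens: "gamma_distribution (\<alpha> + c) = density lborel (\<lambda>t. ennreal (\<rho> t))"
      by (simp add: gamma_distribution_def \<rho>_def)
    have \<rho>_eq: "\<rho> t = (if 0 < t then t powr (\<alpha> + c - 1) * exp (- t) else 0) / Gamma (\<alpha> + c)" for t
      by (simp add: \<rho>_def)
    show "real_distribution (gamma_distribution (\<alpha> + c))"
      unfolding dens
    proof (rule real_distribution_density)
      have "(\<integral>\<^sup>+t. ennreal (\<rho> t) \<partial>lborel)
          = (\<integral>\<^sup>+t. ennreal (if 0 < t then t powr (\<alpha> + c - 1) * exp (- t) else 0) / ennreal (Gamma (\<alpha> + c)) \<partial>lborel)"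
        unfolding \<rho>_eq using \<Gamma> by (intro nn_integral_cong divide_ennreal[symmetric]) auto
      also have "\<dots> = ennreal (Gamma (\<alpha> + c)) / ennreal (Gamma (\<alpha> + c))"
        using integrable_Gamma_integrand(2)[of "\<alpha> + c"] c \<alpha> by (subst nn_integral_divide) auto
      also have "\<dots> = 1" using \<Gamma> by (simp add: divide_ennreal)
      finally show "(\<integral>\<^sup>+t. ennreal (\<rho> t) \<partial>lborel) = 1" .
    qed measurable
    show "integrable (gamma_distribution (\<alpha> + c)) (\<lambda>t. t)"
    proof -
      have "integrable lborel (\<lambda>t. (if 0 < t then t powr (\<alpha> + c + 1 - 1) * exp (- t) else 0) / Gamma (\<alpha> + c))"
        using integrable_Gamma_integrand(1)[of "\<alpha> + c + 1"] c \<alpha> by simp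
      also have "(\<lambda>t. (if 0 < t then t powr (\<alpha> + c + 1 - 1) * exp (- t) else 0) / Gamma (\<alpha> + c)) = (\<lambda>t. \<rho> t *\<^sub>R t)"
        using p\<rho> \<Gamma> by (auto simp: fun_eq_iff defs \<rho>_def mult_ac)
      finally show ?thesis
        unfolding dens using \<rho>_nonneg by (subst integrable_density) auto
    qed
    show "\<rho> \<in> borel_measurable borel" by measurable
    show "\<rho> t \<ge> 0" for t by (rule \<rho>_nonneg)
    show "(0::ereal) < \<infinity>" by simp
    show "\<rho> t = 0" if "\<not> (0 < ereal t \<and> ereal t < \<infinity>)" for t
      using that by (auto simp: \<rho>_def)
    show "((\<lambda>t. p t * \<rho> t) has_real_derivative ((c + 1) * p' t + q t) * \<rho> t) (at t)"
      if "0 < ereal t" for t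
    proof -
      have t: "t > 0" using that by simp
      have "((\<lambda>t. t powr (\<alpha> + c) * exp (- t) / Gamma (\<alpha> + c)) has_real_derivative
          ((c + 1) * p' t + q t) * \<rho> t) (at t)"
        using t \<Gamma> by (auto intro!: derivative_eq_intros simp: defs \<rho>_def powr_diff field_simps)
      thus ?thesis
        by (rule has_field_derivative_transform_within_open[of _ _ _ "{0<..}"]) (use t p\<rho> in auto)
    qed
    show "isCont \<rho> t" if "0 < ereal t" for t
    proof -
      have t: "t > 0" using that by simp
      have "isCont (\<lambda>x. x powr (\<alpha> + c - 1) * exp (- x) / Gamma (\<alpha> + c)) t"
        using t \<Gamma> by (intro continuous_intros) auto
      moreover have "\<forall>\<^sub>F x in nhds t. \<rho> x = x powr (\<alpha> + c - 1) * exp (- x) / Gamma (\<alpha> + c)"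
        using eventually_nhds_in_open[of "{0<..}" t] t
        by (auto elim!: eventually_mono simp: \<rho>_def)
      ultimately show ?thesis by (simp add: isCont_cong)
    qed
    have s: "\<alpha> + c > 0" using c \<alpha> by simp
    have ev: "\<forall>\<^sub>F t in F. t powr (\<alpha> + c) * exp (- t) / Gamma (\<alpha> + c) = p t * \<rho> t"
      if "\<forall>\<^sub>F t in F. t > 0" for F
      using that by eventually_elim (simp add: p\<rho>)
    have l0: "((\<lambda>t. t powr s * exp (- t) / C) \<longlongrightarrow> 0) (at_right 0)" if "s > 0" for s C :: real
      by (rule tendsto_divide_zero) (use that in real_asymp)
    have l1: "((\<lambda>t. t powr s * exp (- t) / C) \<longlongrightarrow> 0) at_top" for s C :: real
      by (rule tendsto_divide_zero) real_asymp
    show "(((\<lambda>t. p t * \<rho> t) \<circ> real_of_ereal) \<longlongrightarrow> 0) (at_right 0)"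
      unfolding zero_ereal_def ereal_tendsto_simps
      by (rule Lim_transform_eventually[OF l0[OF s] ev]) (simp add: eventually_at_right_less)
    show "(((\<lambda>t. p t * \<rho> t) \<circ> real_of_ereal) \<longlongrightarrow> 0) (at_left \<infinity>)"
      unfolding ereal_tendsto_simps
      by (rule Lim_transform_eventually[OF l1 ev]) (rule eventually_gt_at_top)
    show "P z \<noteq> 0" if "Im z > 0" for z using that by (auto simp: defs)
    show "((\<lambda>z. of_real (\<alpha> - 1) * Ln z - z) has_field_derivative Q z / P z) (at z)" if "Im z > 0" for z
    proof -
      have "z \<noteq> 0" using that by auto
      thus ?thesis
        using upper_half_not_nonpos[OF that] unfolding defs
        by (auto intro!: derivative_eq_intros simp: field_simps)
    qed
    show "- 2 * ln y - 0 \<le> Re (of_real (\<alpha> - 1) * Ln (\<i> * of_real y) - \<i> * of_real y)" if "y \<ge> 1" for y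
    proof -
      have "ln y \<ge> 0" using that by simp
      hence "- 2 * ln y \<le> (\<alpha> - 1) * ln y" using \<alpha> by (intro mult_right_mono) auto
      thus ?thesis using that by (simp add: norm_mult)
    qed
  qed
qed

section \<open>The Jacobi ensemble\<close>

text \<open>  \<open>p = x (1 - x)\<close>, \<open>q = a (1 - x) - b x\<close>; the displacement \<open>\<epsilon> p g\<close> multiplies \<open>x\<close> by
  \<open>1 + \<epsilon> (1 - x) g\<close> and \<open>1 - x\<close> by \<open>1 - \<epsilon> x g\<close>, and so preserves the unit interval for small \<open>\<epsilon>\<close>.\<close>

lemma jacobi_markov_krein:
  assumes c: "c > 0" and ab: "a > -1" "b > -1" and htl: "high_temperature_limit \<Omega> X c (jacobi_weight a b) \<mu>"
  shows "markov_krein c (beta_distribution (a + c + 1) (b + c + 1)) \<mu>"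
proof -
  interpret pearson 0 1 "-1" a "- (a + b)" c by unfold_locales (rule c)
  have px: "p x = x * (1 - x)" for x unfolding p_def by (simp add: power2_eq_square algebra_simps)
  have p'x: "p' x = 1 - 2 * x" for x unfolding p'_def by simp
  have qx: "q x = a - (a + b) * x" for x unfolding q_def by (simp add: algebra_simps)
  have Pz: "P z = z * (1 - z)" for z unfolding P_def by (simp add: power2_eq_square algebra_simps)
  have Qz: "Q z = of_real a - of_real (a + b) * z" for z unfolding Q_def by (simp add: algebra_simps)
  let ?B = "Beta (a + c + 1) (b + c + 1)"
  define \<rho> where "\<rho> = (\<lambda>x. if 0 < x \<and> x < 1
    then x powr (a + c) * (1 - x) powr (b + c) / ?B else 0)"
  have B: "?B > 0" unfolding Beta_def using c ab
    by (intro divide_pos_pos mult_pos_pos Gamma_real_pos) auto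
  have w: "jacobi_weight a b x \<ge> 0" for x by (simp add: jacobi_weight_def)
  have [measurable]: "\<rho> \<in> borel_measurable borel" unfolding \<rho>_def by measurable
  have \<rho>_nonneg: "\<rho> t \<ge> 0" for t using B by (simp add: \<rho>_def)
  have p\<rho>: "p t * \<rho> t = t powr (a + c + 1) * (1 - t) powr (b + c + 1) / ?B" if "t > 0" "t < 1" for t
    using that unfolding px by (simp add: \<rho>_def powr_add)
  show ?thesis
  proof (rule high_temperature_markov_krein[OF htl w, where l = 0 and u = 1
        and \<rho> = \<rho> and V = "\<lambda>z. of_real a * Ln z + of_real b * Ln (1 - z)" and K = "\<bar>b\<bar>"])
    \<comment> \<open>the support is bounded, so not moving the particles at all is enough\<close>
    have gain: "jacobi_weight a b x * exp (1 * \<bar>x\<bar> - 1) \<le> jacobi_weight a b (1 * x)" for x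
    proof -
      have "jacobi_weight a b x * exp (1 * \<bar>x\<bar> - 1) \<le> jacobi_weight a b x * 1" if "\<bar>x\<bar> \<le> 1"
        using that w by (intro mult_left_mono) auto
      thus ?thesis by (cases "\<bar>x\<bar> \<le> 1") (auto simp: jacobi_weight_def)
    qed
    show "integrable \<mu> (\<lambda>u. u)"
      by (rule high_temperature_limit_first_moment[OF htl _ w _ _ gain]) (use c in auto)
    show "\<exists>K \<delta>. \<delta> > 0 \<and> (\<forall>\<epsilon> x. \<bar>\<epsilon>\<bar> < \<delta> \<longrightarrow>
        jacobi_weight a b x * exp (\<epsilon> * (q x * Re (\<kappa> / (z - of_real x))) - K * \<epsilon>\<^sup>2)
        \<le> jacobi_weight a b (x + \<epsilon> * (p x * Re (\<kappa> / (z - of_real x)))))" if z: "Im z > 0" for z \<kappa>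
    proof -
      define M where "M = norm \<kappa> / Im z"
      have M: "M \<ge> 0" using z by (simp add: M_def)
      define K where "K = 2 * (\<bar>a\<bar> + \<bar>b\<bar>) * M\<^sup>2"
      show ?thesis
      proof (rule exI[of _ K], rule exI[of _ "1 / (2 * (M + 1))"], intro conjI allI impI)
        show "1 / (2 * (M + 1)) > 0" using M by simp
        fix \<epsilon> x :: real assume \<epsilon>: "\<bar>\<epsilon>\<bar> < 1 / (2 * (M + 1))"
        define g where "g = Re (\<kappa> / (z - of_real x))"
        have g: "\<bar>g\<bar> \<le> M" unfolding g_def M_def by (rule abs_Re_divide_shift_le[OF z])
        have "jacobi_weight a b x * exp (\<epsilon> * (q x * g) - K * \<epsilon>\<^sup>2)
          \<le> jacobi_weight a b (x + \<epsilon> * (p x * g))"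
        proof (cases "0 < x \<and> x < 1")
          case True
          have factor: "\<bar>\<epsilon> * (y * g)\<bar> \<le> 1 / 2"
            "exp (r * (\<epsilon> * (y * g)) - 2 * \<bar>r\<bar> * M\<^sup>2 * \<epsilon>\<^sup>2) \<le> (1 + \<epsilon> * (y * g)) powr r"
            if y: "\<bar>y\<bar> \<le> 1" for y r
          proof -
            have yg: "\<bar>y * g\<bar> \<le> M"
              using mult_mono[OF y g] by (simp add: abs_mult)
            have "\<bar>\<epsilon> * (y * g)\<bar> \<le> 1 / (2 * (M + 1)) * M"
              unfolding abs_mult[of \<epsilon>] using \<epsilon> yg M by (intro mult_mono) auto
            also have "\<dots> \<le> 1 / 2" using M by (simp add: field_simps)
            finally show half: "\<bar>\<epsilon> * (y * g)\<bar> \<le> 1 / 2" .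
            have "2 * \<bar>r\<bar> * (\<epsilon> * (y * g))\<^sup>2 \<le> 2 * \<bar>r\<bar> * M\<^sup>2 * \<epsilon>\<^sup>2"
              by (rule scaled_square_le[OF yg]) simp
            hence "exp (r * (\<epsilon> * (y * g)) - 2 * \<bar>r\<bar> * M\<^sup>2 * \<epsilon>\<^sup>2) \<le> exp (r * (\<epsilon> * (y * g)) - 2 * \<bar>r\<bar> * (\<epsilon> * (y * g))\<^sup>2)"
              by simp
            also have "\<dots> \<le> (1 + \<epsilon> * (y * g)) powr r" by (rule powr_one_plus_ge[OF half])
            finally show "exp (r * (\<epsilon> * (y * g)) - 2 * \<bar>r\<bar> * M\<^sup>2 * \<epsilon>\<^sup>2) \<le> (1 + \<epsilon> * (y * g)) powr r" .
          qed
          have y: "\<bar>1 - x\<bar> \<le> 1" "\<bar>- x\<bar> \<le> 1" using True by auto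
          define A1 A2 where "A1 = 1 + \<epsilon> * ((1 - x) * g)" and "A2 = 1 + \<epsilon> * ((- x) * g)"
          have pos: "A1 > 0" "A2 > 0"
            using factor(1)[OF y(1)] factor(1)[OF y(2)] unfolding A1_def A2_def by linarith+
          have fac: "x + \<epsilon> * (p x * g) = x * A1" "1 - x * A1 = (1 - x) * A2"
            by (unfold px A1_def A2_def, simp_all add: power2_eq_square algebra_simps)
          have in01: "0 < x * A1" "x * A1 < 1"
          proof -
            show "0 < x * A1" using True pos by simp
            have "0 < (1 - x) * A2" using True pos by simp
            thus "x * A1 < 1" unfolding fac(2)[symmetric] by simp
          qed
          have "\<epsilon> * (q x * g) - K * \<epsilon>\<^sup>2
              = (a * (\<epsilon> * ((1 - x) * g)) - 2 * \<bar>a\<bar> * M\<^sup>2 * \<epsilon>\<^sup>2)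
                + (b * (\<epsilon> * ((- x) * g)) - 2 * \<bar>b\<bar> * M\<^sup>2 * \<epsilon>\<^sup>2)"
            unfolding qx K_def by (simp add: algebra_simps)
          hence "exp (\<epsilon> * (q x * g) - K * \<epsilon>\<^sup>2) \<le> A1 powr a * A2 powr b"
            unfolding A1_def A2_def using factor(2)[OF y(1), of a] factor(2)[OF y(2), of b]
            by (simp only: exp_add) (intro mult_mono, auto)
          hence "jacobi_weight a b x * exp (\<epsilon> * (q x * g) - K * \<epsilon>\<^sup>2)
            \<le> jacobi_weight a b x * (A1 powr a * A2 powr b)"
            by (rule mult_left_mono) (rule w)
          also have "\<dots> = jacobi_weight a b (x * A1)"
            using True pos in01 by (simp add: jacobi_weight_def fac(2) powr_mult)
          finally show ?thesis unfolding fac(1) .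
        qed (use w in \<open>auto simp: jacobi_weight_def\<close>)
        thus "jacobi_weight a b x * exp (\<epsilon> * (q x * Re (\<kappa> / (z - of_real x))) - K * \<epsilon>\<^sup>2)
          \<le> jacobi_weight a b (x + \<epsilon> * (p x * Re (\<kappa> / (z - of_real x))))"
          by (simp only: g_def)
      qed
    qed
    show dens: "beta_distribution (a + c + 1) (b + c + 1) = density lborel (\<lambda>t. ennreal (\<rho> t))"
      by (simp add: beta_distribution_def \<rho>_def cong: if_cong)
    show real: "real_distribution (beta_distribution (a + c + 1) (b + c + 1))"
      unfolding dens
    proof (rule real_distribution_density)
      have "((\<lambda>t. t powr (a + c) * (1 - t) powr (b + c)) has_integral ?B) {0..1}"
        using has_integral_Beta_real[of "a + c + 1" "b + c + 1"] c ab by simp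
      hence "((\<lambda>t. t powr (a + c) * (1 - t) powr (b + c) / ?B) has_integral ?B / ?B) {0..1}"
        by (rule has_integral_divide)
      from nn_integral_has_integral_lebesgue[OF _ this]
      have "(\<integral>\<^sup>+t. ennreal (indicator {0..1} t * (t powr (a + c) * (1 - t) powr (b + c) / ?B)) \<partial>lborel) = 1"
        using B by simp
      moreover have "indicator {0..1} t * (t powr (a + c) * (1 - t) powr (b + c) / ?B) = \<rho> t" for t
        by (auto simp: \<rho>_def indicator_def)
      ultimately show "(\<integral>\<^sup>+t. ennreal (\<rho> t) \<partial>lborel) = 1" by (simp only:)
    qed measurable
    show "integrable (beta_distribution (a + c + 1) (b + c + 1)) (\<lambda>t. t)"
    proof -
      interpret real_distribution "beta_distribution (a + c + 1) (b + c + 1)" by (rule real)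
      have "AE t in beta_distribution (a + c + 1) (b + c + 1). norm t \<le> 1"
        unfolding dens by (subst AE_density) (auto simp: \<rho>_def)
      thus ?thesis by (rule integrable_const_bound) simp
    qed
    show "\<rho> \<in> borel_measurable borel" by measurable
    show "\<rho> t \<ge> 0" for t by (rule \<rho>_nonneg)
    show "(0::ereal) < 1" by simp
    show "\<rho> t = 0" if "\<not> (0 < ereal t \<and> ereal t < 1)" for t
      using that by (auto simp: \<rho>_def)
    show "((\<lambda>t. p t * \<rho> t) has_real_derivative ((c + 1) * p' t + q t) * \<rho> t) (at t)"
      if "0 < ereal t" "ereal t < 1" for t
    proof -
      have t: "t > 0" "t < 1" using that by auto
      have "((\<lambda>t. t powr (a + c + 1) * (1 - t) powr (b + c + 1) / ?B) has_real_derivative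
          ((a + c + 1) * t powr (a + c) * (1 - t) powr (b + c + 1)
            - t powr (a + c + 1) * ((b + c + 1) * (1 - t) powr (b + c))) / ?B) (at t)"
        using t B by (auto intro!: derivative_eq_intros)
      also have "((a + c + 1) * t powr (a + c) * (1 - t) powr (b + c + 1)
            - t powr (a + c + 1) * ((b + c + 1) * (1 - t) powr (b + c))) / ?B
          = ((c + 1) * p' t + q t) * \<rho> t"
        unfolding px p'x qx using t B by (simp add: \<rho>_def powr_add field_simps)
      finally show ?thesis
        by (rule has_field_derivative_transform_within_open[of _ _ _ "{0<..<1}"]) (use t p\<rho> in auto)
    qed
    show "isCont \<rho> t" if "0 < ereal t" "ereal t < 1" for t
    proof -
      have t: "t > 0" "t < 1" using that by auto
      have "isCont (\<lambda>x. x powr (a + c) * (1 - x) powr (b + c) / ?B) t"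
        using t B by (intro continuous_intros) auto
      moreover have "\<forall>\<^sub>F x in nhds t. \<rho> x = x powr (a + c) * (1 - x) powr (b + c) / ?B"
        using eventually_nhds_in_open[of "{0<..<1}" t] t
        by (auto elim!: eventually_mono simp: \<rho>_def)
      ultimately show ?thesis by (simp add: isCont_cong)
    qed
    have ev: "\<forall>\<^sub>F t in F. t powr (a + c + 1) * (1 - t) powr (b + c + 1) / ?B = p t * \<rho> t"
      if "\<forall>\<^sub>F t in F. t \<in> {0<..<1}" for F
      using that by eventually_elim (simp add: p\<rho>)
    have l0: "((\<lambda>t. t powr r * (1 - t) powr s / C) \<longlongrightarrow> 0) (at_right 0)" if "r > 0" "s > 0" for r s C :: real
      by (rule tendsto_divide_zero) (use that in real_asymp)
    have l1: "((\<lambda>t. t powr r * (1 - t) powr s / C) \<longlongrightarrow> 0) (at_left 1)" if "r > 0" "s > 0" for r s C :: real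
      by (rule tendsto_divide_zero) (use that in real_asymp)
    have rs: "a + c + 1 > 0" "b + c + 1 > 0" using ab c by auto
    show "(((\<lambda>t. p t * \<rho> t) \<circ> real_of_ereal) \<longlongrightarrow> 0) (at_right 0)"
      unfolding zero_ereal_def ereal_tendsto_simps
      by (rule Lim_transform_eventually[OF l0[OF rs] ev]) (rule eventually_at_right_real, simp)
    show "(((\<lambda>t. p t * \<rho> t) \<circ> real_of_ereal) \<longlongrightarrow> 0) (at_left 1)"
      unfolding one_ereal_def ereal_tendsto_simps
      by (rule Lim_transform_eventually[OF l1[OF rs] ev]) (rule eventually_at_left_real, simp)
    show "P z \<noteq> 0" if "Im z > 0" for z using that unfolding Pz by auto
    show "((\<lambda>z. of_real a * Ln z + of_real b * Ln (1 - z)) has_field_derivative Q z / P z) (at z)"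
      if "Im z > 0" for z
    proof -
      have "1 - z \<notin> \<real>\<^sub>\<le>\<^sub>0" using that by (auto simp: complex_nonpos_Reals_iff)
      hence "((\<lambda>z. of_real a * Ln z + of_real b * Ln (1 - z)) has_field_derivative
          of_real a * (1 / z) + of_real b * (1 / (1 - z) * (- 1))) (at z)"
        using upper_half_not_nonpos[OF that]
        by (auto intro!: derivative_eq_intros simp: divide_inverse)
      also have "of_real a * (1 / z) + of_real b * (1 / (1 - z) * (- 1)) = Q z / P z"
      proof -
        have "z \<noteq> 0" "1 - z \<noteq> 0" using that by auto
        thus ?thesis unfolding Pz Qz by (simp add: divide_simps) (simp add: algebra_simps)
      qed
      finally show ?thesis .
    qed
    show "- 2 * ln y - \<bar>b\<bar> \<le> Re (of_real a * Ln (\<i> * of_real y) + of_real b * Ln (1 - \<i> * of_real y))"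
      if y: "y \<ge> 1" for y
    proof -
      define L where "L = ln (norm (1 - \<i> * complex_of_real y))"
      have ny: "norm (1 - \<i> * complex_of_real y) \<ge> y"
        using abs_Im_le_cmod[of "1 - \<i> * complex_of_real y"] y by simp
      have "norm (1 - \<i> * complex_of_real y) \<le> 1 + y"
        using norm_triangle_ineq4[of 1 "\<i> * complex_of_real y"] y by (simp add: norm_mult)
      also have "\<dots> \<le> exp 1 * y"
      proof -
        have "(2::real) \<le> exp 1" using exp_ge_add_one_self[of 1] by simp
        hence "2 * y \<le> exp 1 * y" using y by (intro mult_right_mono) auto
        moreover have "1 + y \<le> 2 * y" using y by simp
        ultimately show ?thesis by linarith
      qed
      finally have "L \<le> ln (exp 1 * y)" unfolding L_def using ny y by (subst ln_le_cancel_iff) auto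
      hence L: "ln y \<le> L" "L \<le> ln y + 1"
        unfolding L_def using ny y by (auto simp: ln_mult)
      have "b * (L - ln y) \<ge> - \<bar>b\<bar>"
      proof -
        have "\<bar>b * (L - ln y)\<bar> \<le> \<bar>b\<bar> * 1" unfolding abs_mult using L by (intro mult_left_mono) auto
        thus ?thesis by simp
      qed
      moreover have "(a + b) * ln y \<ge> - 2 * ln y"
        using ab y by (intro mult_right_mono) auto
      moreover have "Re (of_real a * Ln (\<i> * of_real y) + of_real b * Ln (1 - \<i> * of_real y)) = a * ln y + b * L"
      proof -
        have "1 - \<i> * complex_of_real y \<noteq> 0" by (auto simp: complex_eq_iff)
        thus ?thesis using y by (simp add: L_def norm_mult)
      qed
      ultimately show ?thesis by (simp add: algebra_simps)
    qed
  qed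
qed

theorem theoremI1:
  fixes c \<alpha> a b :: real
    and \<Omega>G :: "'g measure" and XG :: "nat \<Rightarrow> nat \<Rightarrow> 'g \<Rightarrow> real" and \<mu>G :: "real measure"
    and \<Omega>L :: "'l measure" and XL :: "nat \<Rightarrow> nat \<Rightarrow> 'l \<Rightarrow> real" and \<mu>L :: "real measure"
    and \<Omega>J :: "'j measure" and XJ :: "nat \<Rightarrow> nat \<Rightarrow> 'j \<Rightarrow> real" and \<mu>J :: "real measure"
  assumes "c > 0"
  shows "(high_temperature_limit \<Omega>G XG c gaussian_weight \<mu>G \<longrightarrow>
            markov_krein c std_normal_distribution \<mu>G) \<and>
         (\<alpha> > 0 \<and> high_temperature_limit \<Omega>L XL c (laguerre_weight \<alpha>) \<mu>L \<longrightarrow>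
            markov_krein c (gamma_distribution (\<alpha> + c)) \<mu>L) \<and>
         (a > -1 \<and> b > -1 \<and> high_temperature_limit \<Omega>J XJ c (jacobi_weight a b) \<mu>J \<longrightarrow>
            markov_krein c (beta_distribution (a + c + 1) (b + c + 1)) \<mu>J)"
  using assms gaussian_markov_krein laguerre_markov_krein jacobi_markov_krein by blast

end
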